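(* Let $Q$ be an acyclic quiver with connected components $Q^1,\dots,Q^n$, and let $\mathbf{d}\in\mathbb{Z}_{\geq 0}^{Q_0}$. Then $[Q,\mathbf{d}]=[Q^1,\mathbf{d}^1]\cdots[Q^n,\mathbf{d}^n]$, where $\mathbf{d}^k=(d_i)_{i\in Q^k_0}$ for $k=1,\dots,n$.
   Context: Let $\mathbb{k}=\mathbb{F}_q$ be a finite field. A quiver $Q=(Q_0,Q_1)$ consists of a finite set $Q_0$ of vertices and a finite set $Q_1$ of arrows, each arrow $\alpha$ having a source $s(\alpha)$ and a target $t(\alpha)$ in $Q_0$; multiple arrows are allowed. $Q$ is acyclic if it has no oriented cycles. $Q$ is connected if its underlying (undirected) graph is path-connected; a connected component of $Q$ is a maximal connected subquiver. Paths are written left to right ($cp$ means first $c$, then $p$). For a vertex $i$, $P_Q(i)$ is the indecomposable projective representation of $Q$ over $\mathbb{k}$ at $i$: its space at vertex $j$ has as basis the set of all paths from $i$ to $j$ (including the constant path $e_i$ if $j=i$), and an arrow $\alpha:j\to k$ acts by $c\mapsto c\alpha$. For a summand vector $\mathbf{d}\in\mathbb{Z}_{\geq 0}^{Q_0}$, $P_{Q,\mathbf{d}}:=\bigoplus_{i\in Q_0}P_Q(i)^{d_i}$ and $A_{Q,\mathbf{d}}:=\operatorname{End}(P_{Q,\mathbf{d}})$ is its endomorphism algebra in the category of representations of $Q$ over $\mathbb{k}$. $\operatorname{rad}$ denotes the Jacobson radical. The count $[Q,\mathbf{d}]$ is the number of pairs $(x,y)\in\operatorname{rad}A_{Q,\mathbf{d}}\times\operatorname{rad}A_{Q,\mathbf{d}}$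 with $xy=yx$; it equals $1$ when $\mathbf{d}=\mathbf{0}$. *)

theory Defs
  imports "Graph_Theory.Graph_Theory" "HOL-Algebra.Module" "HOL-Algebra.AbelCoset"
begin

text \<open>
  Quivers are digraphs of type \<^typ>\<open>('v, 'e) pre_digraph\<close>, which allow multiple arcs.
  Set-valued functions are extensional throughout (equal to \<^const>\<open>undefined\<close> outside their
  domain), so that equality in HOL is equality of functions on the domain.
\<close>

section \<open>Vector spaces\<close>

definition linear_maps ::
    "('k, 'r) ring_scheme \<Rightarrow> ('k, 'a, 's) module_scheme \<Rightarrow> ('k, 'b, 't) module_scheme \<Rightarrow> ('a \<Rightarrow> 'b) set"
  where "linear_maps K M N =
    {f \<in> carrier M \<rightarrow>\<^sub>E carrier N.
      (\<forall>x\<in>carrier M. \<forall>y\<in>carrier M. f (x \<oplus>\<^bsub>M\<^esub> y) = f x \<oplus>\<^bsub>N\<^esub> f y) \<and>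
      (\<forall>c\<in>carrier K. \<forall>x\<in>carrier M. f (c \<odot>\<^bsub>M\<^esub> x) = c \<odot>\<^bsub>N\<^esub> f x)}"

text \<open>
  The vector space with basis \<open>S\<close>: a vector is its family of coefficients.  The fields
  \<open>mult\<close> and \<open>one\<close> of a module record play no role for a vector space.
\<close>

definition free_module :: "('k, 'r) ring_scheme \<Rightarrow> 's set \<Rightarrow> ('k, 's \<Rightarrow> 'k) module"
  where "free_module K S =
    \<lparr>carrier = {f \<in> S \<rightarrow>\<^sub>E carrier K. finite {s \<in> S. f s \<noteq> \<zero>\<^bsub>K\<^esub>}},
     mult = undefined, one = undefined,
     zero = (\<lambda>s\<in>S. \<zero>\<^bsub>K\<^esub>),
     add = (\<lambda>f g. \<lambda>s\<in>S. f s \<oplus>\<^bsub>K\<^esub> g s),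
     smult = (\<lambda>c f. \<lambda>s\<in>S. c \<otimes>\<^bsub>K\<^esub> f s)\<rparr>"

definition basis_vector :: "('k, 'r) ring_scheme \<Rightarrow> 's set \<Rightarrow> 's \<Rightarrow> 's \<Rightarrow> 'k"
  where "basis_vector K S t = (\<lambda>s\<in>S. if s = t then \<one>\<^bsub>K\<^esub> else \<zero>\<^bsub>K\<^esub>)"

text \<open>For finite \<open>I\<close>, the product of the family is its direct sum.\<close>

definition module_sum :: "'i set \<Rightarrow> ('i \<Rightarrow> ('k, 'm) module) \<Rightarrow> ('k, 'i \<Rightarrow> 'm) module"
  where "module_sum I M =
    \<lparr>carrier = (\<Pi>\<^sub>E i\<in>I. carrier (M i)),
     mult = undefined, one = undefined,
     zero = (\<lambda>i\<in>I. \<zero>\<^bsub>M i\<^esub>),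
     add = (\<lambda>x y. \<lambda>i\<in>I. x i \<oplus>\<^bsub>M i\<^esub> y i),
     smult = (\<lambda>c x. \<lambda>i\<in>I. c \<odot>\<^bsub>M i\<^esub> x i)\<rparr>"


section \<open>Representations of a quiver\<close>

record ('v, 'e, 'k, 'm) quiver_rep =
  rep_space :: "'v \<Rightarrow> ('k, 'm) module"
  rep_map :: "'e \<Rightarrow> 'm \<Rightarrow> 'm"

definition is_quiver_rep ::
    "('k, 'r) ring_scheme \<Rightarrow> ('v, 'e) pre_digraph \<Rightarrow> ('v, 'e, 'k, 'm) quiver_rep \<Rightarrow> bool"
  where "is_quiver_rep K Q V \<longleftrightarrow>
    (\<forall>i\<in>verts Q. module K (rep_space V i)) \<and>
    (\<forall>a\<in>arcs Q. rep_map V a \<in> linear_maps K (rep_space V (tail Q a)) (rep_space V (head Q a)))"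

definition rep_hom ::
    "('k, 'r) ring_scheme \<Rightarrow> ('v, 'e) pre_digraph \<Rightarrow> ('v, 'e, 'k, 'm) quiver_rep \<Rightarrow>
     ('v, 'e, 'k, 'n) quiver_rep \<Rightarrow> ('v \<Rightarrow> 'm \<Rightarrow> 'n) set"
  where "rep_hom K Q V W =
    {f \<in> (\<Pi>\<^sub>E i\<in>verts Q. linear_maps K (rep_space V i) (rep_space W i)).
      \<forall>a\<in>arcs Q. \<forall>x\<in>carrier (rep_space V (tail Q a)).
        f (head Q a) (rep_map V a x) = rep_map W a (f (tail Q a) x)}"

definition rep_End ::
    "('k, 'r) ring_scheme \<Rightarrow> ('v, 'e) pre_digraph \<Rightarrow> ('v, 'e, 'k, 'm) quiver_rep \<Rightarrow>
     ('k, 'v \<Rightarrow> 'm \<Rightarrow> 'm) module"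
  where "rep_End K Q V =
    \<lparr>carrier = rep_hom K Q V V,
     mult = (\<lambda>f g. \<lambda>i\<in>verts Q. compose (carrier (rep_space V i)) (f i) (g i)),
     one = (\<lambda>i\<in>verts Q. \<lambda>x\<in>carrier (rep_space V i). x),
     zero = (\<lambda>i\<in>verts Q. \<lambda>x\<in>carrier (rep_space V i). \<zero>\<^bsub>rep_space V i\<^esub>),
     add = (\<lambda>f g. \<lambda>i\<in>verts Q. \<lambda>x\<in>carrier (rep_space V i). f i x \<oplus>\<^bsub>rep_space V i\<^esub> g i x),
     smult = (\<lambda>c f. \<lambda>i\<in>verts Q. \<lambda>x\<in>carrier (rep_space V i). c \<odot>\<^bsub>rep_space V i\<^esub> f i x)\<rparr>"

definition rep_sum ::
    "('v, 'e) pre_digraph \<Rightarrow> 'i set \<Rightarrow> ('i \<Rightarrow> ('v, 'e, 'k, 'm) quiver_rep) \<Rightarrow>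
     ('v, 'e, 'k, 'i \<Rightarrow> 'm) quiver_rep"
  where "rep_sum Q I V =
    \<lparr>rep_space = (\<lambda>j. module_sum I (\<lambda>i. rep_space (V i) j)),
     rep_map = (\<lambda>a. \<lambda>x\<in>carrier (module_sum I (\<lambda>i. rep_space (V i) (tail Q a))).
       \<lambda>i\<in>I. rep_map (V i) a (x i))\<rparr>"


section \<open>Projective representations\<close>

text \<open>A path is its list of arcs; the empty list is the constant path.\<close>

definition paths :: "('v, 'e) pre_digraph \<Rightarrow> 'v \<Rightarrow> 'v \<Rightarrow> 'e list set"
  where "paths Q i j = {p. pre_digraph.awalk Q i p j}"

text \<open>
  The arrow \<open>a\<close> acts by the linear extension of \<open>c \<mapsto> c @ [a]\<close>: in the image of \<open>f\<close>, the
  coefficient of a path \<open>p\<close> is \<open>f c\<close> if \<open>p = c @ [a]\<close>, and zero if \<open>p\<close> does not end in \<open>a\<close>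
  (see \<open>proj_rep_map_basis_vector\<close> below).
\<close>

definition proj_rep ::
    "('k, 'r) ring_scheme \<Rightarrow> ('v, 'e) pre_digraph \<Rightarrow> 'v \<Rightarrow> ('v, 'e, 'k, 'e list \<Rightarrow> 'k) quiver_rep"
  where "proj_rep K Q i =
    \<lparr>rep_space = (\<lambda>j. free_module K (paths Q i j)),
     rep_map = (\<lambda>a. \<lambda>f\<in>carrier (free_module K (paths Q i (tail Q a))).
       \<lambda>p\<in>paths Q i (head Q a).
         if p \<noteq> [] \<and> last p = a then f (butlast p) else \<zero>\<^bsub>K\<^esub>)\<rparr>"

text \<open>The summands are indexed by pairs \<open>(i, m)\<close>: the \<open>m\<close>-th copy of the projective at \<open>i\<close>.\<close>

definition proj_sum ::
    "('k, 'r) ring_scheme \<Rightarrow> ('v, 'e) pre_digraph \<Rightarrow> ('v \<Rightarrow> nat) \<Rightarrow>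
     ('v, 'e, 'k, 'v \<times> nat \<Rightarrow> 'e list \<Rightarrow> 'k) quiver_rep"
  where "proj_sum K Q d =
    rep_sum Q (SIGMA i:verts Q. {..<d i}) (\<lambda>(i, m). proj_rep K Q i)"


section \<open>The Jacobson radical\<close>

definition left_ideal :: "'a set \<Rightarrow> ('a, 'b) ring_scheme \<Rightarrow> bool"
  where "left_ideal I R \<longleftrightarrow>
    additive_subgroup I R \<and> (\<forall>r\<in>carrier R. \<forall>x\<in>I. r \<otimes>\<^bsub>R\<^esub> x \<in> I)"

definition maximal_left_ideal :: "'a set \<Rightarrow> ('a, 'b) ring_scheme \<Rightarrow> bool"
  where "maximal_left_ideal I R \<longleftrightarrow>
    left_ideal I R \<and> I \<noteq> carrier R \<and>
    (\<forall>J. left_ideal J R \<and> I \<subseteq> J \<longrightarrow> J = I \<or> J = carrier R)"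

text \<open>The zero ring has no maximal left ideals and is its own radical.\<close>

definition jacobson_radical :: "('a, 'b) ring_scheme \<Rightarrow> 'a set"
  where "jacobson_radical R = {x \<in> carrier R. \<forall>I. maximal_left_ideal I R \<longrightarrow> x \<in> I}"


section \<open>The count of commuting pairs, and connected components\<close>

definition commuting_count ::
    "('k, 'r) ring_scheme \<Rightarrow> ('v, 'e) pre_digraph \<Rightarrow> ('v \<Rightarrow> nat) \<Rightarrow> nat"
  where "commuting_count K Q d =
    (let A = rep_End K Q (proj_sum K Q d) in
      card {(x, y) \<in> jacobson_radical A \<times> jacobson_radical A. x \<otimes>\<^bsub>A\<^esub> y = y \<otimes>\<^bsub>A\<^esub> x})"

text \<open>\<^const>\<open>connected\<close> refers to the underlying undirected graph and excludes the empty one.\<close>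

definition connected_components :: "('v, 'e) pre_digraph \<Rightarrow> ('v, 'e) pre_digraph set"
  where "connected_components Q = {H. pre_digraph.max_subgraph Q connected H}"


section \<open>Consistency of the definitions\<close>

lemma module_free_module:
  assumes "cring K"
  shows "module K (free_module K S)"
proof -
  interpret K: cring K by fact
  have add: "finite {s \<in> S. f s \<oplus>\<^bsub>K\<^esub> g s \<noteq> \<zero>\<^bsub>K\<^esub>}"
    if "finite {s \<in> S. f s \<noteq> \<zero>\<^bsub>K\<^esub>}" "finite {s \<in> S. g s \<noteq> \<zero>\<^bsub>K\<^esub>}" for f g
    by (rule finite_subset[OF _ finite_UnI[OF that]]) auto
  have smult: "finite {s \<in> S. c \<otimes>\<^bsub>K\<^esub> f s \<noteq> \<zero>\<^bsub>K\<^esub>}"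
    if "finite {s \<in> S. f s \<noteq> \<zero>\<^bsub>K\<^esub>}" "c \<in> carrier K" for c f
    by (rule finite_subset[OF _ that(1)]) (use that in auto)
  show ?thesis
  proof (intro moduleI abelian_groupI, goal_cases)
    case (7 x)
    show ?case
    proof (rule bexI)
      show "(\<lambda>s\<in>S. \<ominus>\<^bsub>K\<^esub> x s) \<oplus>\<^bsub>free_module K S\<^esub> x = \<zero>\<^bsub>free_module K S\<^esub>"
        using 7 by (auto simp: free_module_def K.l_neg PiE_iff restrict_def fun_eq_iff)
      have "finite {s \<in> S. \<ominus>\<^bsub>K\<^esub> x s \<noteq> \<zero>\<^bsub>K\<^esub>}"
        by (rule finite_subset[of _ "{s \<in> S. x s \<noteq> \<zero>\<^bsub>K\<^esub>}"]) (use 7 in \<open>auto simp: free_module_def\<close>)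
      then show "(\<lambda>s\<in>S. \<ominus>\<^bsub>K\<^esub> x s) \<in> carrier (free_module K S)"
        using 7 by (auto simp: free_module_def PiE_iff cong: conj_cong)
    qed
  qed (auto simp: free_module_def PiE_iff restrict_def fun_eq_iff extensional_def add smult assms
         K.a_ac K.l_distr K.r_distr K.m_assoc cong: conj_cong)
qed

lemma module_module_sum:
  assumes "cring K" and "\<And>i. i \<in> I \<Longrightarrow> module K (M i)"
  shows "module K (module_sum I M)"
proof -
  have ag: "abelian_group (M i)" if "i \<in> I" for i
    using assms(2)[OF that] by (simp add: module_def)
  then have am: "abelian_monoid (M i)" if "i \<in> I" for i
    using that by (simp add: abelian_group_def)
  show ?thesis
  proof (intro moduleI abelian_groupI, goal_cases)
    case (7 x)
    then show ?case
      by (intro bexI[of _ "\<lambda>i\<in>I. \<ominus>\<^bsub>M i\<^esub> x i"])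
        (auto simp: module_sum_def PiE_iff restrict_def fun_eq_iff extensional_def
           abelian_group.l_neg[OF ag] abelian_group.a_inv_closed[OF ag])
  qed (auto simp: module_sum_def PiE_iff restrict_def fun_eq_iff extensional_def assms(1)
         abelian_groupE(1-5)[OF ag] abelian_monoid.a_lcomm[OF am]
         abelian_monoid.a_comm[OF am] abelian_monoid.r_zero[OF am] module.smult_closed[OF assms(2)]
         module.smult_l_distr[OF assms(2)] module.smult_r_distr[OF assms(2)]
         module.smult_assoc1[OF assms(2)] module.smult_one[OF assms(2)])
qed

lemma paths_snoc_iff:
  assumes "wf_digraph Q"
  shows "c @ [a] \<in> paths Q i j \<longleftrightarrow> a \<in> arcs Q \<and> head Q a = j \<and> c \<in> paths Q i (tail Q a)"
proof -
  interpret wf_digraph Q by fact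
  show ?thesis
    by (auto simp: paths_def awalk_simps)
qed

lemma proj_rep_map_basis_vector:
  assumes "field K" and "wf_digraph Q" and "a \<in> arcs Q" and "c \<in> paths Q i (tail Q a)"
  shows "rep_map (proj_rep K Q i) a (basis_vector K (paths Q i (tail Q a)) c) =
    basis_vector K (paths Q i (head Q a)) (c @ [a])"
proof -
  interpret K: field K by fact
  have "basis_vector K S c \<in> carrier (free_module K S)" for S
    by (auto simp: basis_vector_def free_module_def PiE_iff
        intro: finite_subset[of _ "{c}"])
  then show ?thesis
    using paths_snoc_iff[OF assms(2)] assms(3)
    by (auto simp: proj_rep_def basis_vector_def fun_eq_iff restrict_def)
       (metis append_butlast_last_id)
qed

lemma is_quiver_rep_proj_rep:
  assumes "field K" and "wf_digraph Q"
  shows "is_quiver_rep K Q (proj_rep K Q i)"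
  unfolding is_quiver_rep_def
proof (intro conjI ballI)
  interpret K: field K by fact
  show "module K (rep_space (proj_rep K Q i) j)" for j
    by (simp add: proj_rep_def module_free_module K.is_cring)
  fix a assume a: "a \<in> arcs Q"
  have p: "butlast p \<in> paths Q i (tail Q (last p))" if "p \<in> paths Q i j" "p \<noteq> []" for p j
    using that paths_snoc_iff[OF assms(2), of "butlast p" "last p"] by simp
  have fin: "finite {p \<in> paths Q i (head Q a). (if p \<noteq> [] \<and> last p = a then f (butlast p) else \<zero>\<^bsub>K\<^esub>) \<noteq> \<zero>\<^bsub>K\<^esub>}"
    if "finite {p \<in> paths Q i (tail Q a). f p \<noteq> \<zero>\<^bsub>K\<^esub>}" for f
  proof (rule finite_subset[OF _ finite_imageI[OF that, of "\<lambda>c. c @ [a]"]], intro subsetI, clarsimp split: if_splits)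
    fix q assume "q \<in> paths Q i (head Q (last q))" "f (butlast q) \<noteq> \<zero>\<^bsub>K\<^esub>" "q \<noteq> []"
    then show "q \<in> (\<lambda>c. c @ [last q]) ` {p \<in> paths Q i (tail Q (last q)). f p \<noteq> \<zero>\<^bsub>K\<^esub>}"
      by (intro image_eqI[of _ _ "butlast q"]) (auto dest: p)
  qed
  interpret M: module K "free_module K (paths Q i (tail Q a))"
    by (rule module_free_module) (rule K.is_cring)
  show "rep_map (proj_rep K Q i) a \<in>
      linear_maps K (rep_space (proj_rep K Q i) (tail Q a)) (rep_space (proj_rep K Q i) (head Q a))"
    unfolding linear_maps_def
  proof (intro CollectI conjI ballI, goal_cases)
    case 1
    then show ?case
      by (auto simp: proj_rep_def free_module_def PiE_iff fin p cong: conj_cong)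
  next
    case (2 x y)
    then show ?case using M.a_closed[of x y] p
      by (auto simp: proj_rep_def) (auto simp: free_module_def fun_eq_iff restrict_def p)
  next
    case (3 c x)
    then show ?case using M.smult_closed[of c x] p
      by (auto simp: proj_rep_def) (auto simp: free_module_def fun_eq_iff restrict_def p)
  qed
qed

lemma is_quiver_rep_rep_sum:
  assumes "cring K" and "\<And>i. i \<in> I \<Longrightarrow> is_quiver_rep K Q (V i)" and "wf_digraph Q"
  shows "is_quiver_rep K Q (rep_sum Q I V)"
proof -
  have lin: "rep_map (V i) a \<in> linear_maps K (rep_space (V i) (tail Q a)) (rep_space (V i) (head Q a))"
    if "i \<in> I" "a \<in> arcs Q" for i a
    using assms(2)[OF that(1)] that(2) by (simp add: is_quiver_rep_def)
  have m: "module K (module_sum I (\<lambda>i. rep_space (V i) j))" if "j \<in> verts Q" for j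
    using assms(1,2) that by (intro module_module_sum) (auto simp: is_quiver_rep_def)
  have "rep_map (rep_sum Q I V) a \<in> linear_maps K (rep_space (rep_sum Q I V) (tail Q a))
    (rep_space (rep_sum Q I V) (head Q a))" if a: "a \<in> arcs Q" for a
  proof -
    interpret M: module K "module_sum I (\<lambda>i. rep_space (V i) (tail Q a))"
      using m wf_digraph.tail_in_verts[OF assms(3) a] by blast
    show ?thesis
      unfolding linear_maps_def
    proof (intro CollectI conjI ballI, goal_cases)
      case 1
      then show ?case using lin[OF _ a]
        by (auto simp: rep_sum_def module_sum_def PiE_iff linear_maps_def)
    next
      case (2 x y)
      then show ?case using M.a_closed[of x y] lin[OF _ a]
        by (auto simp: rep_sum_def) (auto simp: module_sum_def fun_eq_iff restrict_def linear_maps_def PiE_iff)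
    next
      case (3 c x)
      then show ?case using M.smult_closed[of c x] lin[OF _ a]
        by (auto simp: rep_sum_def) (auto simp: module_sum_def fun_eq_iff restrict_def linear_maps_def PiE_iff)
    qed
  qed
  with m show ?thesis
    by (auto simp: is_quiver_rep_def rep_sum_def)
qed

lemma is_quiver_rep_proj_sum:
  assumes "field K" and "wf_digraph Q"
  shows "is_quiver_rep K Q (proj_sum K Q d)"
proof -
  interpret K: field K by fact
  show ?thesis
    unfolding proj_sum_def
    by (rule is_quiver_rep_rep_sum) (auto simp: is_quiver_rep_proj_rep assms K.is_cring)
qed

lemma linear_mapsI:
  assumes "\<And>x. x \<in> carrier M \<Longrightarrow> f x \<in> carrier N" "f \<in> extensional (carrier M)"
    and "\<And>x y. x \<in> carrier M \<Longrightarrow> y \<in> carrier M \<Longrightarrow> f (x \<oplus>\<^bsub>M\<^esub> y) = f x \<oplus>\<^bsub>N\<^esub> f y"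
    and "\<And>c x. c \<in> carrier K \<Longrightarrow> x \<in> carrier M \<Longrightarrow> f (c \<odot>\<^bsub>M\<^esub> x) = c \<odot>\<^bsub>N\<^esub> f x"
  shows "f \<in> linear_maps K M N"
  using assms by (auto simp: linear_maps_def PiE_iff)

lemma linear_mapsD:
  assumes "f \<in> linear_maps K M N"
  shows "x \<in> carrier M \<Longrightarrow> f x \<in> carrier N" "x \<notin> carrier M \<Longrightarrow> f x = undefined"
    and "x \<in> carrier M \<Longrightarrow> y \<in> carrier M \<Longrightarrow> f (x \<oplus>\<^bsub>M\<^esub> y) = f x \<oplus>\<^bsub>N\<^esub> f y"
    and "c \<in> carrier K \<Longrightarrow> x \<in> carrier M \<Longrightarrow> f (c \<odot>\<^bsub>M\<^esub> x) = c \<odot>\<^bsub>N\<^esub> f x"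
  using assms by (auto simp: linear_maps_def PiE_iff extensional_def)

lemma rep_homI:
  assumes "\<And>i. i \<in> verts Q \<Longrightarrow> f i \<in> linear_maps K (rep_space V i) (rep_space W i)"
    and "f \<in> extensional (verts Q)"
    and "\<And>a x. a \<in> arcs Q \<Longrightarrow> x \<in> carrier (rep_space V (tail Q a)) \<Longrightarrow>
      f (head Q a) (rep_map V a x) = rep_map W a (f (tail Q a) x)"
  shows "f \<in> rep_hom K Q V W"
  using assms by (auto simp: rep_hom_def PiE_iff)

lemma rep_homD:
  assumes "f \<in> rep_hom K Q V W"
  shows "i \<in> verts Q \<Longrightarrow> f i \<in> linear_maps K (rep_space V i) (rep_space W i)"
    and "i \<notin> verts Q \<Longrightarrow> f i = undefined"
    and "a \<in> arcs Q \<Longrightarrow> x \<in> carrier (rep_space V (tail Q a)) \<Longrightarrow>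
      f (head Q a) (rep_map V a x) = rep_map W a (f (tail Q a) x)"
  using assms by (auto simp: rep_hom_def PiE_iff extensional_def)

lemma rep_hom_eqI:
  assumes "f \<in> rep_hom K Q V W" and "g \<in> rep_hom K Q V W"
    and "\<And>i x. i \<in> verts Q \<Longrightarrow> x \<in> carrier (rep_space V i) \<Longrightarrow> f i x = g i x"
  shows "f = g"
proof (intro ext)
  fix i x
  show "f i x = g i x"
  proof (cases "i \<in> verts Q")
    case True
    then show ?thesis
      using assms(3) linear_mapsD(2)[OF rep_homD(1)[OF assms(1) True]]
        linear_mapsD(2)[OF rep_homD(1)[OF assms(2) True]] by metis
  qed (use rep_homD(2)[OF assms(1)] rep_homD(2)[OF assms(2)] in simp)
qed

lemma linear_map_zero:
  assumes "module K M" and "module K N" and "f \<in> linear_maps K M N"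
  shows "f \<zero>\<^bsub>M\<^esub> = \<zero>\<^bsub>N\<^esub>"
proof -
  interpret M: module K M by fact
  interpret N: module K N by fact
  show ?thesis
    using linear_mapsD(4)[OF assms(3), of "\<zero>\<^bsub>K\<^esub>" "\<zero>\<^bsub>M\<^esub>"] linear_mapsD(1)[OF assms(3), of "\<zero>\<^bsub>M\<^esub>"]
    by simp
qed

lemma linear_map_minus:
  assumes "module K M" and "module K N" and "f \<in> linear_maps K M N" and "x \<in> carrier M"
  shows "f (\<ominus>\<^bsub>M\<^esub> x) = \<ominus>\<^bsub>N\<^esub> f x"
proof -
  interpret M: module K M by fact
  interpret N: module K N by fact
  show ?thesis
    using linear_mapsD(3)[OF assms(3), of "\<ominus>\<^bsub>M\<^esub> x" x] linear_mapsD(1)[OF assms(3)] assms(4)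
      linear_map_zero[OF assms(1-3)] N.minus_equality[of "f (\<ominus>\<^bsub>M\<^esub> x)" "f x"]
    by (simp add: M.l_neg)
qed

lemma linear_maps_zero_map:
  assumes "module K M" and "module K N"
  shows "(\<lambda>x\<in>carrier M. \<zero>\<^bsub>N\<^esub>) \<in> linear_maps K M N"
proof -
  interpret M: module K M by fact
  interpret N: module K N by fact
  show ?thesis by (rule linear_mapsI) auto
qed

lemma linear_maps_id:
  assumes "module K M"
  shows "(\<lambda>x\<in>carrier M. x) \<in> linear_maps K M M"
proof -
  interpret M: module K M by fact
  show ?thesis by (rule linear_mapsI) auto
qed

lemma linear_maps_add:
  assumes "module K M" and "module K N" and "f \<in> linear_maps K M N" and "g \<in> linear_maps K M N"
  shows "(\<lambda>x\<in>carrier M. f x \<oplus>\<^bsub>N\<^esub> g x) \<in> linear_maps K M N"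
proof -
  interpret M: module K M by fact
  interpret N: module K N by fact
  note fg = linear_mapsD[OF assms(3)] linear_mapsD[OF assms(4)]
  show ?thesis by (rule linear_mapsI) (auto simp: fg N.a_ac N.smult_r_distr)
qed

lemma linear_maps_minus:
  assumes "module K M" and "module K N" and "f \<in> linear_maps K M N"
  shows "(\<lambda>x\<in>carrier M. \<ominus>\<^bsub>N\<^esub> f x) \<in> linear_maps K M N"
proof -
  interpret M: module K M by fact
  interpret N: module K N by fact
  note f = linear_mapsD[OF assms(3)]
  show ?thesis by (rule linear_mapsI) (auto simp: f N.minus_add N.smult_r_minus)
qed

lemma linear_maps_compose:
  assumes "module K M" and "g \<in> linear_maps K M N" and "f \<in> linear_maps K N P"
  shows "compose (carrier M) f g \<in> linear_maps K M P"
proof -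
  interpret M: module K M by fact
  show ?thesis
    by (rule linear_mapsI) (auto simp: compose_def linear_mapsD[OF assms(2)] linear_mapsD[OF assms(3)])
qed

lemma ring_rep_End:
  assumes V: "is_quiver_rep K Q V" and Q: "wf_digraph Q"
  shows "ring (rep_End K Q V)"
proof -
  interpret wf_digraph Q by fact
  let ?E = "rep_End K Q V"
  have m: "module K (rep_space V i)" if "i \<in> verts Q" for i
    using V that by (simp add: is_quiver_rep_def)
  have ag: "abelian_group (rep_space V i)" if "i \<in> verts Q" for i
    using m[OF that] by (simp add: module_def)
  have am: "abelian_monoid (rep_space V i)" if "i \<in> verts Q" for i
    using ag[OF that] by (simp add: abelian_group_def)
  have r: "rep_map V a \<in> linear_maps K (rep_space V (tail Q a)) (rep_space V (head Q a))"
    if "a \<in> arcs Q" for a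
    using V that by (simp add: is_quiver_rep_def)
  note rD = linear_mapsD(1,3)[OF r] linear_map_zero[OF m m r] linear_map_minus[OF m m r]
  have c: "carrier ?E = rep_hom K Q V V"
    by (simp add: rep_End_def)
  have clo: "f i x \<in> carrier (rep_space V i)"
    if "f \<in> carrier ?E" "i \<in> verts Q" "x \<in> carrier (rep_space V i)" for f i x
    using linear_mapsD(1)[OF rep_homD(1)] that c by metis
  have add: "f i (x \<oplus>\<^bsub>rep_space V i\<^esub> y) = f i x \<oplus>\<^bsub>rep_space V i\<^esub> f i y"
    if "f \<in> carrier ?E" "i \<in> verts Q" "x \<in> carrier (rep_space V i)" "y \<in> carrier (rep_space V i)" for f i x y
    using linear_mapsD(3)[OF rep_homD(1)] that c by metis
  have nat: "f (head Q a) (rep_map V a x) = rep_map V a (f (tail Q a) x)"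
    if "f \<in> carrier ?E" "a \<in> arcs Q" "x \<in> carrier (rep_space V (tail Q a))" for f a x
    using rep_homD(3) that c by metis
  have ops:
    "\<And>i x. \<lbrakk>i \<in> verts Q; x \<in> carrier (rep_space V i)\<rbrakk> \<Longrightarrow> (f \<otimes>\<^bsub>?E\<^esub> g) i x = f i (g i x)"
    "\<And>i x. \<lbrakk>i \<in> verts Q; x \<in> carrier (rep_space V i)\<rbrakk> \<Longrightarrow> (f \<oplus>\<^bsub>?E\<^esub> g) i x = f i x \<oplus>\<^bsub>rep_space V i\<^esub> g i x"
    "\<And>i x. \<lbrakk>i \<in> verts Q; x \<in> carrier (rep_space V i)\<rbrakk> \<Longrightarrow> \<one>\<^bsub>?E\<^esub> i x = x"
    "\<And>i x. \<lbrakk>i \<in> verts Q; x \<in> carrier (rep_space V i)\<rbrakk> \<Longrightarrow> \<zero>\<^bsub>?E\<^esub> i x = \<zero>\<^bsub>rep_space V i\<^esub>" for f g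
    by (simp_all add: rep_End_def compose_def)
  have lin: "f i \<in> linear_maps K (rep_space V i) (rep_space V i)" if "f \<in> carrier ?E" "i \<in> verts Q" for f i
    using rep_homD(1) that c by metis
  have mult: "f \<otimes>\<^bsub>?E\<^esub> g \<in> carrier ?E" if "f \<in> carrier ?E" "g \<in> carrier ?E" for f g
    unfolding c
  proof (rule rep_homI)
    show "(f \<otimes>\<^bsub>?E\<^esub> g) i \<in> linear_maps K (rep_space V i) (rep_space V i)" if "i \<in> verts Q" for i
      using linear_maps_compose[OF m lin lin] that \<open>f \<in> _\<close> \<open>g \<in> _\<close> by (simp add: rep_End_def)
  qed (use that in \<open>simp_all add: ops rD clo nat\<close>, simp add: rep_End_def)
  have plus: "f \<oplus>\<^bsub>?E\<^esub> g \<in> carrier ?E" if "f \<in> carrier ?E" "g \<in> carrier ?E" for f g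
    unfolding c
  proof (rule rep_homI)
    show "(f \<oplus>\<^bsub>?E\<^esub> g) i \<in> linear_maps K (rep_space V i) (rep_space V i)" if "i \<in> verts Q" for i
      using linear_maps_add[OF m m lin lin] that \<open>f \<in> _\<close> \<open>g \<in> _\<close> by (simp add: rep_End_def)
  qed (use that in \<open>simp_all add: ops rD clo nat\<close>, simp add: rep_End_def)
  have one: "\<one>\<^bsub>?E\<^esub> \<in> carrier ?E"
    unfolding c
  proof (rule rep_homI)
    show "\<one>\<^bsub>?E\<^esub> i \<in> linear_maps K (rep_space V i) (rep_space V i)" if "i \<in> verts Q" for i
      using linear_maps_id[OF m] that by (simp add: rep_End_def)
  qed (simp_all add: ops rD, simp add: rep_End_def)
  have zero: "\<zero>\<^bsub>?E\<^esub> \<in> carrier ?E"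
    unfolding c
  proof (rule rep_homI)
    show "\<zero>\<^bsub>?E\<^esub> i \<in> linear_maps K (rep_space V i) (rep_space V i)" if "i \<in> verts Q" for i
      using linear_maps_zero_map[OF m m] that by (simp add: rep_End_def)
  qed (simp_all add: ops rD, simp add: rep_End_def)
  have minus: "\<exists>g\<in>carrier ?E. g \<oplus>\<^bsub>?E\<^esub> f = \<zero>\<^bsub>?E\<^esub>" if f: "f \<in> carrier ?E" for f
  proof
    let ?g = "\<lambda>i\<in>verts Q. \<lambda>x\<in>carrier (rep_space V i). \<ominus>\<^bsub>rep_space V i\<^esub> f i x"
    show g: "?g \<in> carrier ?E"
      unfolding c
    proof (rule rep_homI)
      show "?g i \<in> linear_maps K (rep_space V i) (rep_space V i)" if "i \<in> verts Q" for i
        using linear_maps_minus[OF m m lin] that f by simp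
    qed (use f in \<open>simp_all add: rD clo nat\<close>)
    show "?g \<oplus>\<^bsub>?E\<^esub> f = \<zero>\<^bsub>?E\<^esub>"
      using plus[OF g f] zero unfolding c
      by (rule rep_hom_eqI) (simp add: ops abelian_group.l_neg[OF ag] clo f)
  qed
  note closed = mult plus one zero
  note eqI = rep_hom_eqI[of _ K Q V V, folded c]
  show ?thesis
  proof (intro ringI abelian_groupI monoidI)
    show "\<exists>y\<in>carrier ?E. y \<oplus>\<^bsub>?E\<^esub> x = \<zero>\<^bsub>?E\<^esub>" if "x \<in> carrier ?E" for x
      by (rule minus) fact
  qed (auto intro!: eqI closed simp: ops closed clo add abelian_monoid.a_ac[OF am]
      abelian_monoid.l_zero[OF am])
qed

lemma commuting_count_zero:
  assumes "field K" and "wf_digraph Q" and "\<And>i. i \<in> verts Q \<Longrightarrow> d i = 0"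
  shows "commuting_count K Q d = 1"
proof -
  let ?V = "proj_sum K Q d" and ?E = "rep_End K Q (proj_sum K Q d)"
  have V: "is_quiver_rep K Q ?V"
    by (rule is_quiver_rep_proj_sum) fact+
  interpret ring ?E
    by (rule ring_rep_End) fact+
  have "(SIGMA i:verts Q. {..<d i}) = {}"
    using assms(3) by auto
  then have "carrier (rep_space ?V i) = {\<lambda>_. undefined}" for i
    by (simp add: proj_sum_def rep_sum_def module_sum_def)
  then have "f = g" if "f \<in> carrier ?E" "g \<in> carrier ?E" for f g
    using that linear_mapsD(1)[OF rep_homD(1)[of f K Q ?V ?V]] linear_mapsD(1)[OF rep_homD(1)[of g K Q ?V ?V]]
    by (intro rep_hom_eqI[of f K Q ?V ?V g]) (auto simp: rep_End_def)
  then have c: "carrier ?E = {\<zero>\<^bsub>?E\<^esub>}"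
    using zero_closed by blast
  have "\<not> maximal_left_ideal I ?E" for I
  proof
    assume I: "maximal_left_ideal I ?E"
    then have "subgroup I (add_monoid ?E)" "I \<noteq> carrier ?E"
      by (auto simp: maximal_left_ideal_def left_ideal_def additive_subgroup_def)
    then show False
      using subgroup.subset[of I "add_monoid ?E"] subgroup.one_closed[of I "add_monoid ?E"] c by auto
  qed
  then have "jacobson_radical ?E = {\<zero>\<^bsub>?E\<^esub>}"
    by (auto simp: jacobson_radical_def c)
  then have "{(x, y) \<in> jacobson_radical ?E \<times> jacobson_radical ?E. x \<otimes>\<^bsub>?E\<^esub> y = y \<otimes>\<^bsub>?E\<^esub> x} =
      {(\<zero>\<^bsub>?E\<^esub>, \<zero>\<^bsub>?E\<^esub>)}"
    by auto
  then show ?thesis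
    by (simp add: commuting_count_def)
qed

end

theory Submission
  imports Defs
begin

text \<open>
  A path never leaves its connected component, so \<open>P\<^bsub>Q,d\<^esub>\<close> restricted to a component \<open>H\<close> is
  \<open>P\<^bsub>H,d\<^esub>\<close>, and an endomorphism of a representation of \<open>Q\<close> is the same as a family of
  endomorphisms of its restrictions to the components.  Hence \<open>A\<^bsub>Q,d\<^esub>\<close> is the product of the
  rings \<open>A\<^bsub>H,d\<^esub>\<close>.  The Jacobson radical of a finite product of rings is the product of the
  radicals, and two elements commute iff their components do.
\<close>

section \<open>The radical of a product of rings\<close>

text \<open>The restriction of \<open>proj_sum K Q d\<close> to a component \<open>H\<close> is not
  literally the sum of projectives of \<open>H\<close>: the copies of projectives at vertices
  outside \<open>H\<close> stay in the index set, with zero spaces at all vertices of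
  \<open>H\<close>. The two representations are only isomorphic, so the count also has to be
  invariant under isomorphism. The radical is given by maximal left ideals, and the delicate half of
  its compatibility with products is that every maximal left ideal of the product comes from a
  single factor. This uses that there are finitely many factors, since 1 has to be a finite sum of
  idempotents.\<close>

lemma left_idealI:
  assumes "ring R" and "I \<subseteq> carrier R" and "\<zero>\<^bsub>R\<^esub> \<in> I"
    and add: "\<And>x y. x \<in> I \<Longrightarrow> y \<in> I \<Longrightarrow> x \<oplus>\<^bsub>R\<^esub> y \<in> I"
    and mult: "\<And>r x. r \<in> carrier R \<Longrightarrow> x \<in> I \<Longrightarrow> r \<otimes>\<^bsub>R\<^esub> x \<in> I"
  shows "left_ideal I R"
proof -
  interpret ring R by fact
  have "\<ominus>\<^bsub>R\<^esub> x \<in> I" if "x \<in> I" for x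
  proof -
    have "x \<in> carrier R" using that assms(2) by blast
    then have "\<ominus>\<^bsub>R\<^esub> x = (\<ominus>\<^bsub>R\<^esub> \<one>\<^bsub>R\<^esub>) \<otimes>\<^bsub>R\<^esub> x" by (simp add: l_minus)
    then show ?thesis using mult[OF _ that] by simp
  qed
  then have "subgroup I (add_monoid R)"
    using assms(2,3) add by (intro add.subgroupI) (auto simp: a_inv_def)
  then show ?thesis
    using mult by (auto simp: left_ideal_def additive_subgroup_def)
qed

lemma left_idealD:
  assumes "left_ideal I R"
  shows "x \<in> I \<Longrightarrow> x \<in> carrier R" and "\<zero>\<^bsub>R\<^esub> \<in> I"
    and "x \<in> I \<Longrightarrow> y \<in> I \<Longrightarrow> x \<oplus>\<^bsub>R\<^esub> y \<in> I"
    and "r \<in> carrier R \<Longrightarrow> x \<in> I \<Longrightarrow> r \<otimes>\<^bsub>R\<^esub> x \<in> I"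
proof -
  interpret additive_subgroup I R
    using assms by (simp add: left_ideal_def)
  show "x \<in> I \<Longrightarrow> x \<in> carrier R" and "\<zero>\<^bsub>R\<^esub> \<in> I"
    and "x \<in> I \<Longrightarrow> y \<in> I \<Longrightarrow> x \<oplus>\<^bsub>R\<^esub> y \<in> I"
    and "r \<in> carrier R \<Longrightarrow> x \<in> I \<Longrightarrow> r \<otimes>\<^bsub>R\<^esub> x \<in> I"
    using assms by (auto simp: left_ideal_def)
qed

lemma left_ideal_eq_carrierI:
  assumes "ring R" and "left_ideal I R" and "\<one>\<^bsub>R\<^esub> \<in> I"
  shows "I = carrier R"
proof -
  interpret ring R by fact
  show ?thesis
    using left_idealD(4)[OF assms(2) _ assms(3)] left_idealD(1)[OF assms(2)] by fastforce
qed

section \<open>Maximal left ideals along a surjective ring homomorphism\<close>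

locale surj_ring_hom = R: ring R + S: ring S for R (structure) and S (structure) +
  fixes h
  assumes hom: "h \<in> ring_hom R S" and surj: "h ` carrier R = carrier S"
begin

lemmas hom_simps = ring_hom_closed[OF hom] ring_hom_mult[OF hom] ring_hom_add[OF hom]
  ring_hom_one[OF hom] ring_hom_zero[OF hom R.ring_axioms S.ring_axioms]

lemma left_ideal_preimage:
  assumes "left_ideal J S"
  shows "left_ideal {x \<in> carrier R. h x \<in> J} R"
  by (rule left_idealI) (auto simp: hom_simps R.ring_axioms left_idealD[OF assms])

lemma left_ideal_image:
  assumes "left_ideal L R"
  shows "left_ideal (h ` L) S"
proof (rule left_idealI)
  show "h ` L \<subseteq> carrier S"
    using left_idealD(1)[OF assms] by (auto simp: hom_simps)
  show "\<zero>\<^bsub>S\<^esub> \<in> h ` L"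
    using left_idealD(2)[OF assms] hom_simps(5) by (metis imageI)
  show "x \<oplus>\<^bsub>S\<^esub> y \<in> h ` L" if "x \<in> h ` L" "y \<in> h ` L" for x y
    using that left_idealD(1,3)[OF assms] by (auto simp flip: hom_simps(3))
  show "r \<otimes>\<^bsub>S\<^esub> x \<in> h ` L" if "r \<in> carrier S" "x \<in> h ` L" for r x
    using that left_idealD(1,4)[OF assms] by (auto simp flip: hom_simps(2) surj)
qed (rule S.ring_axioms)

lemma preimage_eq_carrierD:
  assumes "{x \<in> carrier R. h x \<in> J} = carrier R"
  shows "carrier S \<subseteq> J"
proof
  fix s assume "s \<in> carrier S"
  then obtain x where "x \<in> carrier R" "s = h x" using surj by blast
  then show "s \<in> J" using assms by blast
qed

text \<open>A left ideal above the preimage contains the kernel of \<open>h\<close> and is therefore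
  determined by its image, for which the maximality of \<open>J\<close> leaves two choices.\<close>

lemma maximal_left_ideal_preimage:
  assumes "maximal_left_ideal J S"
  shows "maximal_left_ideal {x \<in> carrier R. h x \<in> J} R" (is "maximal_left_ideal ?P R")
  unfolding maximal_left_ideal_def
proof (intro conjI allI impI)
  have J: "left_ideal J S" "J \<noteq> carrier S"
    and max: "\<And>J'. left_ideal J' S \<Longrightarrow> J \<subseteq> J' \<Longrightarrow> J' = J \<or> J' = carrier S"
    using assms by (auto simp: maximal_left_ideal_def)
  show "left_ideal ?P R" by (rule left_ideal_preimage) fact
  show "?P \<noteq> carrier R"
    using J(2) preimage_eq_carrierD[of J] left_idealD(1)[OF J(1)] by blast
  fix L assume "left_ideal L R \<and> ?P \<subseteq> L"
  then have L: "left_ideal L R" and PL: "?P \<subseteq> L" by auto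
  have "J \<subseteq> h ` L"
    using PL left_idealD(1)[OF J(1)] surj by (smt (verit) image_iff mem_Collect_eq subset_iff)
  then consider "h ` L = J" | "h ` L = carrier S"
    using max[OF left_ideal_image[OF L]] by blast
  then show "L = ?P \<or> L = carrier R"
  proof cases
    case 1
    then show ?thesis using PL left_idealD(1)[OF L] by auto
  next
    case 2
    \<comment> \<open>Some \<open>l\<close> in \<open>L\<close> has the same image as
      \<open>x\<close>. Their difference lies in the kernel, which is contained in \<open>?P\<close>
      because \<open>J\<close> contains 0, and hence in \<open>L\<close>.\<close>
    have "x \<in> L" if x: "x \<in> carrier R" for x
    proof -
      obtain l where l: "l \<in> L" "h l = h x"
        using 2 hom_simps(1)[OF x] by (metis image_iff)
      have lc: "l \<in> carrier R" using left_idealD(1)[OF L l(1)] .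
      have "h (x \<oplus>\<^bsub>R\<^esub> \<ominus> l) = h (l \<oplus>\<^bsub>R\<^esub> \<ominus> l)"
        using l(2) x lc by (simp only: hom_simps R.a_inv_closed)
      then have "h (x \<oplus>\<^bsub>R\<^esub> \<ominus> l) = \<zero>\<^bsub>S\<^esub>"
        using lc by (simp add: R.r_neg hom_simps)
      then have "x \<oplus>\<^bsub>R\<^esub> \<ominus> l \<in> L"
        using PL x lc left_idealD(2)[OF J(1)] by auto
      from left_idealD(3)[OF L this l(1)] show ?thesis
        using x lc by (simp add: R.a_assoc R.l_neg)
    qed
    then show ?thesis using left_idealD(1)[OF L] by blast
  qed
qed

text \<open>The preimage of the image contains \<open>M\<close> and is proper, so it equals
  \<open>M\<close> by maximality. This second conclusion is what later decides membership in
  \<open>M\<close> by looking at a single coordinate.\<close>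

lemma maximal_left_ideal_image:
  assumes "maximal_left_ideal M R" and "h ` M \<noteq> carrier S"
  shows "maximal_left_ideal (h ` M) S" and "{x \<in> carrier R. h x \<in> h ` M} = M"
proof -
  have M: "left_ideal M R"
    and max: "\<And>L. left_ideal L R \<Longrightarrow> M \<subseteq> L \<Longrightarrow> L = M \<or> L = carrier R"
    using assms by (auto simp: maximal_left_ideal_def)
  note hM = left_ideal_image[OF M]
  have "{x \<in> carrier R. h x \<in> h ` M} \<noteq> carrier R"
    using assms(2) preimage_eq_carrierD[of "h ` M"] left_idealD(1)[OF hM] by blast
  then show "{x \<in> carrier R. h x \<in> h ` M} = M"
    using max[OF left_ideal_preimage[OF hM]] left_idealD(1)[OF M] by auto
  show "maximal_left_ideal (h ` M) S"
    unfolding maximal_left_ideal_def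
  proof (intro conjI allI impI hM assms(2))
    fix J assume "left_ideal J S \<and> h ` M \<subseteq> J"
    then have J: "left_ideal J S" "h ` M \<subseteq> J" by auto
    have "h ` {x \<in> carrier R. h x \<in> J} = J"
      using surj left_idealD(1)[OF J(1)] by (auto simp: image_iff)
    moreover have "M \<subseteq> {x \<in> carrier R. h x \<in> J}"
      using J(2) left_idealD(1)[OF M] by blast
    ultimately show "J = h ` M \<or> J = carrier S"
      using max[OF left_ideal_preimage[OF J(1)]] surj by metis
  qed
qed

end

text \<open>An internal description of \<open>R \<cong> \<Prod>k\<in>I. S k\<close>; with a singleton \<open>I\<close> it expresses an isomorphism.\<close>

locale ring_product = R: ring R for R (structure) +
  fixes I :: "'i set" and S :: "'i \<Rightarrow> ('b, 's) ring_scheme" and p :: "'i \<Rightarrow> 'a \<Rightarrow> 'b"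
  assumes finite_index: "finite I"
    and ring_factor: "k \<in> I \<Longrightarrow> ring (S k)"
    and proj_hom: "k \<in> I \<Longrightarrow> p k \<in> ring_hom R (S k)"
    and proj_bij: "bij_betw (\<lambda>x. \<lambda>k\<in>I. p k x) (carrier R) (\<Pi>\<^sub>E k\<in>I. carrier (S k))"
begin

lemma proj_eqI:
  assumes "x \<in> carrier R" "y \<in> carrier R" "\<And>k. k \<in> I \<Longrightarrow> p k x = p k y"
  shows "x = y"
proof (rule inj_onD[OF bij_betw_imp_inj_on[OF proj_bij] _ assms(1,2)])
  show "(\<lambda>k\<in>I. p k x) = (\<lambda>k\<in>I. p k y)"
    using assms(3) by (intro restrict_ext) simp
qed

lemma obtain_element:
  assumes "\<And>k. k \<in> I \<Longrightarrow> s k \<in> carrier (S k)"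
  obtains x where "x \<in> carrier R" "\<And>k. k \<in> I \<Longrightarrow> p k x = s k"
proof -
  have "restrict s I \<in> (\<lambda>x. \<lambda>k\<in>I. p k x) ` carrier R"
    using bij_betw_imp_surj_on[OF proj_bij] assms by auto
  then obtain x where x: "x \<in> carrier R" "restrict s I = (\<lambda>k\<in>I. p k x)" by blast
  show thesis
  proof (rule that[OF x(1)])
    show "p k x = s k" if "k \<in> I" for k
      using fun_cong[OF x(2), of k] that by simp
  qed
qed

lemma surj_ring_hom_proj:
  assumes k: "k \<in> I"
  shows "surj_ring_hom R (S k) (p k)"
proof -
  have "s \<in> p k ` carrier R" if s: "s \<in> carrier (S k)" for s
  proof -
    \<comment> \<open>Any lift with \<open>s\<close> at \<open>k\<close> will do; 1 is just a filler
      available in every factor.\<close>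
    obtain x where "x \<in> carrier R" "\<And>j. j \<in> I \<Longrightarrow> p j x = (if j = k then s else \<one>\<^bsub>S j\<^esub>)"
      by (rule obtain_element[of "\<lambda>j. if j = k then s else \<one>\<^bsub>S j\<^esub>"])
        (use s monoid.one_closed[OF ring.is_monoid[OF ring_factor]] in auto)
    then show ?thesis using k by force
  qed
  then show ?thesis
    using proj_hom[OF k] ring_factor[OF k]
    by (auto simp: surj_ring_hom_def surj_ring_hom_axioms_def R.ring_axioms ring_hom_closed)
qed

text \<open>
  A maximal left ideal containing the central idempotents of all factors contains their sum, which
  is \<open>1\<close>.  So it misses one of them, and then it is pulled back from that factor.
\<close>

lemma maximal_left_ideal_proper_image:
  assumes M: "maximal_left_ideal M R"
  shows "\<exists>k\<in>I. p k ` M \<noteq> carrier (S k)"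
proof (rule ccontr)
  assume "\<not> ?thesis"
  then have full: "p k ` M = carrier (S k)" if "k \<in> I" for k using that by blast
  have L: "left_ideal M R" "M \<noteq> carrier R" using M by (auto simp: maximal_left_ideal_def)
  note ringS = ring.ring_simprules(1-7)[OF ring_factor]
  \<comment> \<open>The idempotent belonging to a set \<open>F\<close> of factors is built up inside
    \<open>M\<close>, one factor at a time; for \<open>F = I\<close> it is 1.\<close>
  have "\<exists>e\<in>M. \<forall>j\<in>I. p j e = (if j \<in> F then \<one>\<^bsub>S j\<^esub> else \<zero>\<^bsub>S j\<^esub>)" if "F \<subseteq> I" for F
    using finite_subset[OF that finite_index] that
  proof (induction F rule: finite_induct)
    case empty
    show ?case
      using left_idealD(2)[OF L(1)] ring_hom_zero[OF proj_hom R.ring_axioms ring_factor] by auto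
  next
    case (insert k F)
    then obtain e where e: "e \<in> M" "\<And>j. j \<in> I \<Longrightarrow> p j e = (if j \<in> F then \<one>\<^bsub>S j\<^esub> else \<zero>\<^bsub>S j\<^esub>)"
      by blast
    have k: "k \<in> I" using insert by simp
    then obtain m where m: "m \<in> M" "p k m = \<one>\<^bsub>S k\<^esub>"
      using full monoid.one_closed[OF ring.is_monoid[OF ring_factor[OF k]]] by (metis image_iff)
    \<comment> \<open>The element \<open>m\<close> of \<open>M\<close> is 1 at \<open>k\<close> but
      unknown elsewhere. Multiplying it on the left by the idempotent \<open>u\<close> of the factor
      \<open>k\<close> clears the other coordinates and stays in the left ideal. As \<open>k\<close>
      is not in \<open>F\<close>, adding the result to \<open>e\<close> gives exactly 1 at
      \<open>k\<close>.\<close>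
    obtain u where u: "u \<in> carrier R" "\<And>j. j \<in> I \<Longrightarrow> p j u = (if j = k then \<one>\<^bsub>S j\<^esub> else \<zero>\<^bsub>S j\<^esub>)"
      by (rule obtain_element[of "\<lambda>j. if j = k then \<one>\<^bsub>S j\<^esub> else \<zero>\<^bsub>S j\<^esub>"])
        (auto simp: ring.ring_simprules(2,6)[OF ring_factor])
    note c = left_idealD(1)[OF L(1)]
    show ?case
    proof (intro bexI ballI)
      show "e \<oplus>\<^bsub>R\<^esub> u \<otimes> m \<in> M"
        by (intro left_idealD(3,4)[OF L(1)] e m u)
      fix j assume j: "j \<in> I"
      interpret Sj: ring "S j" by (rule ring_factor[OF j])
      interpret Sk: ring "S k" by (rule ring_factor[OF k])
      have "p j (e \<oplus>\<^bsub>R\<^esub> u \<otimes> m) = p j e \<oplus>\<^bsub>S j\<^esub> p j u \<otimes>\<^bsub>S j\<^esub> p j m"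
        using c[OF e(1)] c[OF m(1)] u(1)
        by (simp add: ring_hom_add[OF proj_hom[OF j]] ring_hom_mult[OF proj_hom[OF j]])
      then show "p j (e \<oplus>\<^bsub>R\<^esub> u \<otimes> m) = (if j \<in> insert k F then \<one>\<^bsub>S j\<^esub> else \<zero>\<^bsub>S j\<^esub>)"
        using insert(2) m(2) ring_hom_closed[OF proj_hom[OF j] c[OF m(1)]]
        by (auto simp: e(2)[OF j] u(2)[OF j])
    qed
  qed
  from this[OF subset_refl] obtain e where e: "e \<in> M" "\<And>j. j \<in> I \<Longrightarrow> p j e = \<one>\<^bsub>S j\<^esub>"
    by auto
  have "e = \<one>"
    by (rule proj_eqI) (auto simp: e left_idealD(1)[OF L(1)] ring_hom_one[OF proj_hom])
  then show False
    using left_ideal_eq_carrierI[OF R.ring_axioms L(1)] e(1) L(2) by blast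
qed

text \<open>The maximal left ideals of \<open>R\<close> are exactly the preimages of those of the
  factors: preimages are maximal, and conversely each one has a proper image in some factor and is
  the preimage of that image.\<close>

lemma jacobson_radical_iff:
  "x \<in> jacobson_radical R \<longleftrightarrow> x \<in> carrier R \<and> (\<forall>k\<in>I. p k x \<in> jacobson_radical (S k))"
proof safe
  fix k assume x: "x \<in> jacobson_radical R" and k: "k \<in> I"
  interpret pk: surj_ring_hom R "S k" "p k" by (rule surj_ring_hom_proj[OF k])
  show "p k x \<in> jacobson_radical (S k)"
    using x pk.maximal_left_ideal_preimage
    by (auto simp: jacobson_radical_def pk.hom_simps)
next
  assume x: "x \<in> carrier R" and rad: "\<forall>k\<in>I. p k x \<in> jacobson_radical (S k)"
  have "x \<in> M" if M: "maximal_left_ideal M R" for M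
  proof -
    obtain k where k: "k \<in> I" "p k ` M \<noteq> carrier (S k)"
      using maximal_left_ideal_proper_image[OF M] by blast
    interpret pk: surj_ring_hom R "S k" "p k" by (rule surj_ring_hom_proj[OF k(1)])
    have "p k x \<in> p k ` M"
      using pk.maximal_left_ideal_image(1)[OF M k(2)] rad k(1) by (auto simp: jacobson_radical_def)
    then show ?thesis
      using pk.maximal_left_ideal_image(2)[OF M k(2)] x by blast
  qed
  then show "x \<in> jacobson_radical R"
    using x by (simp add: jacobson_radical_def)
qed (simp add: jacobson_radical_def)

end

section \<open>Counting commuting pairs in the radical\<close>

text \<open>Stated for an arbitrary ring because the factors that arise first, the endomorphism
  rings over a component \<open>H\<close> of the sum of projectives of \<open>Q\<close>, are not of
  the form treated by \<open>commuting_count\<close>.\<close>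

definition commuting_radical_pairs :: "('a, 'b) ring_scheme \<Rightarrow> ('a \<times> 'a) set"
  where "commuting_radical_pairs A =
    {(x, y) \<in> jacobson_radical A \<times> jacobson_radical A. x \<otimes>\<^bsub>A\<^esub> y = y \<otimes>\<^bsub>A\<^esub> x}"

text \<open>Membership in the radical and commutation can both be tested coordinatewise, so a
  commuting pair of \<open>R\<close> amounts to an independent choice of a commuting pair in each
  factor.\<close>

lemma (in ring_product) card_commuting_radical_pairs:
  "card (commuting_radical_pairs R) = (\<Prod>k\<in>I. card (commuting_radical_pairs (S k)))"
proof -
  let ?f = "\<lambda>(x, y). \<lambda>k\<in>I. (p k x, p k y)"
  have comm: "x \<otimes> y = y \<otimes> x \<longleftrightarrow> (\<forall>k\<in>I. p k x \<otimes>\<^bsub>S k\<^esub> p k y = p k y \<otimes>\<^bsub>S k\<^esub> p k x)"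
    if "x \<in> carrier R" "y \<in> carrier R" for x y
    using that proj_eqI[of "x \<otimes> y" "y \<otimes> x"] by (auto simp flip: ring_hom_mult[OF proj_hom])
  have mem: "(x, y) \<in> commuting_radical_pairs R \<longleftrightarrow>
      x \<in> carrier R \<and> y \<in> carrier R \<and> (\<forall>k\<in>I. (p k x, p k y) \<in> commuting_radical_pairs (S k))" for x y
    using comm by (auto simp: commuting_radical_pairs_def jacobson_radical_iff)
  have "bij_betw ?f (commuting_radical_pairs R) (\<Pi>\<^sub>E k\<in>I. commuting_radical_pairs (S k))"
    unfolding bij_betw_def
  proof (intro conjI equalityI subsetI)
    show "inj_on ?f (commuting_radical_pairs R)"
    proof (rule inj_onI, clarify)
      fix x y x' y'
      assume xy: "(x, y) \<in> commuting_radical_pairs R" "(x', y') \<in> commuting_radical_pairs R"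
        and eq: "(\<lambda>k\<in>I. (p k x, p k y)) = (\<lambda>k\<in>I. (p k x', p k y'))"
      have "p k x = p k x' \<and> p k y = p k y'" if "k \<in> I" for k
        using fun_cong[OF eq, of k] that by simp
      then show "x = x' \<and> y = y'"
        using xy by (simp add: mem proj_eqI)
    qed
    show "g \<in> (\<Pi>\<^sub>E k\<in>I. commuting_radical_pairs (S k))" if "g \<in> ?f ` commuting_radical_pairs R" for g
      using that mem by auto
    fix g assume g: "g \<in> (\<Pi>\<^sub>E k\<in>I. commuting_radical_pairs (S k))"
    then have gk: "g k \<in> commuting_radical_pairs (S k)" if "k \<in> I" for k using that by blast
    have "fst (g k) \<in> carrier (S k)" "snd (g k) \<in> carrier (S k)" if "k \<in> I" for k
      using gk[OF that] by (auto simp: commuting_radical_pairs_def jacobson_radical_def)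
    then obtain x y where xy: "x \<in> carrier R" "\<And>k. k \<in> I \<Longrightarrow> p k x = fst (g k)"
        "y \<in> carrier R" "\<And>k. k \<in> I \<Longrightarrow> p k y = snd (g k)"
      using obtain_element[of "\<lambda>k. fst (g k)"] obtain_element[of "\<lambda>k. snd (g k)"] by metis
    show "g \<in> ?f ` commuting_radical_pairs R"
    proof (rule image_eqI[of _ _ "(x, y)"])
      show "g = ?f (x, y)" using g xy by (auto simp: fun_eq_iff PiE_iff extensional_def)
      show "(x, y) \<in> commuting_radical_pairs R" using gk xy by (auto simp: mem)
    qed
  qed
  from bij_betw_same_card[OF this] show ?thesis
    by (simp add: card_PiE finite_index)
qed

text \<open>An isomorphism is a product decomposition with one factor, so the invariance of the
  radical is a case of the product result.\<close>

lemma card_commuting_radical_pairs_iso: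
  assumes "ring R" and "ring S" and "h \<in> ring_hom R S" and "bij_betw h (carrier R) (carrier S)"
  shows "card (commuting_radical_pairs R) = card (commuting_radical_pairs S)"
proof -
  interpret R: ring R by fact
  interpret ring_product R "{()}" "\<lambda>_. S" "\<lambda>_. h"
  proof (intro ring_product.intro ring_product_axioms.intro)
    have "bij_betw (\<lambda>s. \<lambda>k\<in>{()}. s) (carrier S) (\<Pi>\<^sub>E k\<in>{()}. carrier S)"
      by (rule bij_betwI[of _ _ _ "\<lambda>g. g ()"]) auto
    from bij_betw_trans[OF assms(4) this]
    show "bij_betw (\<lambda>x. \<lambda>k\<in>{()}. h x) (carrier R) (\<Pi>\<^sub>E k\<in>{()}. carrier S)"
      by (simp add: comp_def)
  qed (use assms in auto)
  show ?thesis
    using card_commuting_radical_pairs by simp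
qed


section \<open>Connected components\<close>

lemma union_simps [simp]:
  "verts (union G H) = verts G \<union> verts H" "arcs (union G H) = arcs G \<union> arcs H"
  "tail (union G H) = tail G" "head (union G H) = head G"
  by (simp_all add: union_def)

text \<open>Connectedness is strong connectedness of the symmetrised graph. For compatible graphs
  symmetrisation commutes with \<open>union\<close>, which reduces the claim to strongly connected
  graphs sharing a vertex.\<close>

lemma connected_union:
  assumes "wf_digraph G" "wf_digraph H" "compatible G H"
    and "connected G" "connected H" and "verts G \<inter> verts H \<noteq> {}"
  shows "connected (union G H)"
proof -
  have wf: "wf_digraph (with_proj (mk_symmetric G))" "wf_digraph (with_proj (mk_symmetric H))"
    using wf_digraph.wellformed_mk_symmetric assms(1,2)
    by (simp_all add: wf_digraph_wp_iff)
  have "with_proj (mk_symmetric (union G H)) =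
      union (with_proj (mk_symmetric G)) (with_proj (mk_symmetric H))"
    using assms(3) by (auto simp: mk_symmetric_def with_proj_def union_def compatible_def)
  then show ?thesis
    using strongly_connected_non_disj[OF wf compatibleI_with_proj] assms(4-6)
    by (simp add: connected_def)
qed

lemma (in wf_digraph) connected_arc_subgraph:
  assumes "a \<in> arcs G"
  defines "A \<equiv> \<lparr>verts = {tail G a, head G a}, arcs = {a}, tail = tail G, head = head G\<rparr>"
  shows "subgraph A G" and "connected A"
proof -
  have wf: "wf_digraph A"
    by unfold_locales (auto simp: A_def)
  show "subgraph A G"
    using assms wf_digraph_axioms wf by (auto simp: subgraph_def compatible_def)
  show "connected A"
    unfolding connected_conv
  proof (intro conjI ballI)
    show "verts A \<noteq> {}" by (simp add: A_def)
    fix u v assume "u \<in> verts A" "v \<in> verts A"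
    moreover have "(tail G a, head G a) \<in> (arcs_ends A)\<^sup>s" "(head G a, tail G a) \<in> (arcs_ends A)\<^sup>s"
      by (auto simp: A_def symcl_def arcs_ends_conv)
    ultimately show "(u, v) \<in> rtrancl_on (verts A) ((arcs_ends A)\<^sup>s)"
      by (auto simp: A_def intro: rtrancl_on_into_rtrancl_on rtrancl_on_refl)
  qed
qed

lemma in_connected_components:
  assumes "H \<in> connected_components Q"
  shows "subgraph H Q" "connected H" "verts H \<subseteq> verts Q" "arcs H \<subseteq> arcs Q"
    "tail H = tail Q" "head H = head Q" "wf_digraph H" "wf_digraph Q"
  using assms
  by (auto simp: connected_components_def pre_digraph.max_subgraph_def subgraph_def compatible_def)

text \<open>The union with \<open>H\<close> is again a connected subgraph of \<open>Q\<close>, so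
  maximality of \<open>H\<close> makes it equal to \<open>H\<close>.\<close>

lemma connected_subgraph_subset_component:
  assumes H: "H \<in> connected_components Q" and H': "subgraph H' Q" "connected H'"
    and meet: "verts H \<inter> verts H' \<noteq> {}"
  shows "subgraph H' H"
proof -
  note c = in_connected_components[OF H]
  have comp: "compatible H H'" and wf: "wf_digraph H'"
    using H'(1) c by (auto simp: subgraph_def compatible_def)
  have "subgraph (union H H') Q"
    using subgraph_union[OF c(1) _ H'(1)] comp c(5,6) by (simp add: compatible_def)
  moreover have "connected (union H H')"
    by (rule connected_union[OF c(7) wf comp c(2) H'(2) meet])
  moreover have "subgraph H (union H H')"
    by (rule subgraphs_of_union(1)[OF c(7) wf comp])
  ultimately have "union H H' = H"
    using H by (auto simp: connected_components_def pre_digraph.max_subgraph_def)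
  then show ?thesis
    using subgraphs_of_union(2)[OF c(7) wf comp] by simp
qed

lemma connected_components_disjoint:
  assumes "H \<in> connected_components Q" "H' \<in> connected_components Q"
    and "v \<in> verts H" "v \<in> verts H'"
  shows "H = H'"
proof -
  have "subgraph H' H" "subgraph H H'"
    using connected_subgraph_subset_component[OF assms(1) in_connected_components(1,2)[OF assms(2)]]
      connected_subgraph_subset_component[OF assms(2) in_connected_components(1,2)[OF assms(1)]]
      assms(3,4) by blast+
  then show ?thesis by (auto simp: subgraph_def compatible_def)
qed

text \<open>The arrow together with its ends is a connected subgraph meeting \<open>H\<close>, so
  \<open>H\<close> absorbs it. Consequently no arrow joins two components.\<close>

lemma connected_components_arc:
  assumes H: "H \<in> connected_components Q" and a: "a \<in> arcs Q"
    and "tail Q a \<in> verts H \<or> head Q a \<in> verts H"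
  shows "a \<in> arcs H"
proof -
  interpret wf_digraph Q by (rule in_connected_components(8)[OF H])
  show ?thesis
    using connected_subgraph_subset_component[OF H connected_arc_subgraph[OF a]] assms(3)
    by (auto simp: subgraph_def)
qed

text \<open>Among the connected subgraphs through \<open>v\<close>, one with the largest total
  number of vertices and arrows is maximal; the single vertex \<open>v\<close> shows that there are
  candidates.\<close>

lemma (in fin_digraph) connected_components_cover:
  assumes v: "v \<in> verts G"
  obtains H where "H \<in> connected_components G" "v \<in> verts H"
proof -
  let ?P = "\<lambda>H. subgraph H G \<and> connected H \<and> v \<in> verts H"
  let ?size = "\<lambda>H. card (verts H) + card (arcs H)"
  define H0 where "H0 = \<lparr>verts = {v}, arcs = {}, tail = tail G, head = head G\<rparr>"
  have "wf_digraph H0" by unfold_locales (auto simp: H0_def)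
  then have "?P H0"
    using v wf_digraph_axioms
    by (auto simp: H0_def subgraph_def compatible_def connected_conv)
  moreover have bound: "?size H < Suc (?size G)" if "?P H" for H
    using that by (auto simp: subgraph_def less_Suc_eq_le intro!: add_mono card_mono)
  ultimately obtain H where H: "?P H" and max: "\<And>H'. ?P H' \<Longrightarrow> ?size H' \<le> ?size H"
    using ex_has_greatest_nat[of ?P H0 ?size "Suc (?size G)"] by blast
  have "H' = H" if H': "subgraph H H'" "subgraph H' G" "connected H'" for H'
  proof -
    have sub: "verts H \<subseteq> verts H'" "arcs H \<subseteq> arcs H'" and fin: "finite (verts H')" "finite (arcs H')"
      using H' finite_subset[of "verts H'" "verts G"] finite_subset[of "arcs H'" "arcs G"]
      by (auto simp: subgraph_def)
    \<comment> \<open>Neither summand of the size can drop when passing to \<open>H'\<close>, and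
      their sum does not grow, so both are unchanged.\<close>
    have "?size H' \<le> ?size H" using max[of H'] H' H sub by blast
    then have "card (verts H') \<le> card (verts H)" "card (arcs H') \<le> card (arcs H)"
      using card_mono[OF fin(1) sub(1)] card_mono[OF fin(2) sub(2)] by linarith+
    then have "verts H = verts H'" "arcs H = arcs H'"
      using card_seteq[OF fin(1) sub(1)] card_seteq[OF fin(2) sub(2)] by auto
    then show ?thesis using H'(1) by (auto simp: subgraph_def compatible_def)
  qed
  then have "H \<in> connected_components G"
    using H by (auto simp: connected_components_def max_subgraph_def)
  then show thesis using H that by blast
qed

text \<open>Components are nonempty and pairwise disjoint, so each is determined by its vertex
  set.\<close>

lemma (in fin_digraph) finite_connected_components: "finite (connected_components G)"
proof (rule finite_imageD)
  show "finite (verts ` connected_components G)"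
    by (rule finite_subset[of _ "Pow (verts G)"]) (use in_connected_components(3)[of _ G] in auto)
  show "inj_on verts (connected_components G)"
  proof (rule inj_onI)
    fix H H' assume H: "H \<in> connected_components G" "H' \<in> connected_components G" "verts H = verts H'"
    obtain v where "v \<in> verts H"
      using in_connected_components(2)[OF H(1)] unfolding connected_conv by blast
    then show "H = H'"
      using connected_components_disjoint[OF H(1,2), of v] H(3) by simp
  qed
qed

text \<open>Only the end of the path is known to lie in \<open>H\<close>, so the induction strips
  arrows from the right: the last arrow ends in \<open>H\<close>, hence belongs to \<open>H\<close>,
  and its tail is a vertex of \<open>H\<close> again.\<close>

lemma paths_connected_component:
  assumes H: "H \<in> connected_components Q" and j: "j \<in> verts H"
  shows "paths Q i j = (if i \<in> verts H then paths H i j else {})"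
proof -
  note c = in_connected_components[OF H]
  interpret Q: wf_digraph Q by (rule c(8))
  interpret H: wf_digraph H by (rule c(7))
  have "p \<in> paths Q i j \<longleftrightarrow> i \<in> verts H \<and> p \<in> paths H i j" for p
    using j
  proof (induction p arbitrary: j rule: rev_induct)
    case Nil
    then show ?case using c(3) by (auto simp: paths_def Q.awalk_simps H.awalk_simps)
  next
    case (snoc a p)
    then show ?case
      using connected_components_arc[OF H, of a] c(4-6) H.tail_in_verts[of a]
      by (auto simp: paths_snoc_iff[OF c(7)] paths_snoc_iff[OF c(8)])
  qed
  then show ?thesis by auto
qed


section \<open>Endomorphism rings of representations\<close>

lemma is_quiver_repD:
  assumes "is_quiver_rep K Q V"
  shows "i \<in> verts Q \<Longrightarrow> module K (rep_space V i)"
    and "a \<in> arcs Q \<Longrightarrow> rep_map V a \<in> linear_maps K (rep_space V (tail Q a)) (rep_space V (head Q a))"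
    and "a \<in> arcs Q \<Longrightarrow> x \<in> carrier (rep_space V (tail Q a)) \<Longrightarrow>
      rep_map V a x \<in> carrier (rep_space V (head Q a))"
proof -
  show "i \<in> verts Q \<Longrightarrow> module K (rep_space V i)"
    and lin: "a \<in> arcs Q \<Longrightarrow>
      rep_map V a \<in> linear_maps K (rep_space V (tail Q a)) (rep_space V (head Q a))"
    using assms by (simp_all add: is_quiver_rep_def)
  show "a \<in> arcs Q \<Longrightarrow> x \<in> carrier (rep_space V (tail Q a)) \<Longrightarrow>
      rep_map V a x \<in> carrier (rep_space V (head Q a))"
    by (rule linear_mapsD(1)[OF lin])
qed

text \<open>Restriction to a subquiver leaves the record unchanged and reads it at fewer vertices
  and arrows. Thus \<open>rep_End K H V\<close> is the endomorphism ring of the restriction of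
  \<open>V\<close> to \<open>H\<close>.\<close>

lemma is_quiver_rep_subgraph:
  assumes "is_quiver_rep K Q V" and "subgraph H Q"
  shows "is_quiver_rep K H V"
  using assms by (auto simp: is_quiver_rep_def subgraph_def compatible_def)

text \<open>The multiplication of \<open>rep_End\<close>, extended to morphisms between different
  representations; the source \<open>V\<close> supplies the domains that keep the result
  extensional.\<close>

definition rep_compose ::
    "('v, 'e) pre_digraph \<Rightarrow> ('v, 'e, 'k, 'l) quiver_rep \<Rightarrow> ('v \<Rightarrow> 'm \<Rightarrow> 'n) \<Rightarrow> ('v \<Rightarrow> 'l \<Rightarrow> 'm) \<Rightarrow>
      'v \<Rightarrow> 'l \<Rightarrow> 'n"
  where "rep_compose Q V g f = (\<lambda>i\<in>verts Q. compose (carrier (rep_space V i)) (g i) (f i))"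

lemma rep_compose_apply:
  "i \<in> verts Q \<Longrightarrow> x \<in> carrier (rep_space V i) \<Longrightarrow> rep_compose Q V g f i x = g i (f i x)"
  by (simp add: rep_compose_def compose_def)

lemma rep_hom_closed:
  "f \<in> rep_hom K Q V W \<Longrightarrow> i \<in> verts Q \<Longrightarrow> x \<in> carrier (rep_space V i) \<Longrightarrow> f i x \<in> carrier (rep_space W i)"
  by (rule linear_mapsD(1)[OF rep_homD(1)])

lemma rep_hom_add:
  "f \<in> rep_hom K Q V W \<Longrightarrow> i \<in> verts Q \<Longrightarrow> x \<in> carrier (rep_space V i) \<Longrightarrow> y \<in> carrier (rep_space V i) \<Longrightarrow>
    f i (x \<oplus>\<^bsub>rep_space V i\<^esub> y) = f i x \<oplus>\<^bsub>rep_space W i\<^esub> f i y"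
  by (rule linear_mapsD(3)[OF rep_homD(1)])

lemma rep_hom_compose:
  assumes "is_quiver_rep K Q V" and "wf_digraph Q"
    and f: "f \<in> rep_hom K Q V W" and g: "g \<in> rep_hom K Q W U"
  shows "rep_compose Q V g f \<in> rep_hom K Q V U"
proof (rule rep_homI)
  interpret wf_digraph Q by fact
  note V = is_quiver_repD[OF assms(1)]
  show "rep_compose Q V g f i \<in> linear_maps K (rep_space V i) (rep_space U i)" if "i \<in> verts Q" for i
    using linear_maps_compose[OF V(1) rep_homD(1)[OF f] rep_homD(1)[OF g]] that
    by (simp add: rep_compose_def)
  show "rep_compose Q V g f \<in> extensional (verts Q)"
    by (simp add: rep_compose_def)
  show "rep_compose Q V g f (head Q a) (rep_map V a x) = rep_map U a (rep_compose Q V g f (tail Q a) x)"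
    if "a \<in> arcs Q" "x \<in> carrier (rep_space V (tail Q a))" for a x
    using that by (simp add: rep_compose_apply V(3) rep_homD(3)[OF f] rep_homD(3)[OF g] rep_hom_closed[OF f])
qed

lemma rep_End_apply:
  assumes "i \<in> verts Q" and "x \<in> carrier (rep_space V i)"
  shows "(f \<otimes>\<^bsub>rep_End K Q V\<^esub> g) i x = f i (g i x)"
    and "(f \<oplus>\<^bsub>rep_End K Q V\<^esub> g) i x = f i x \<oplus>\<^bsub>rep_space V i\<^esub> g i x"
    and "\<one>\<^bsub>rep_End K Q V\<^esub> i x = x"
  using assms by (simp_all add: rep_End_def compose_def)

lemma card_commuting_radical_pairs_rep_End_iso:
  assumes V: "is_quiver_rep K Q V" and W: "is_quiver_rep K Q W" and Q: "wf_digraph Q"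
    and \<phi>: "\<phi> \<in> rep_hom K Q V W" and \<psi>: "\<psi> \<in> rep_hom K Q W V"
    and \<psi>\<phi>: "\<And>i x. i \<in> verts Q \<Longrightarrow> x \<in> carrier (rep_space V i) \<Longrightarrow> \<psi> i (\<phi> i x) = x"
    and \<phi>\<psi>: "\<And>i x. i \<in> verts Q \<Longrightarrow> x \<in> carrier (rep_space W i) \<Longrightarrow> \<phi> i (\<psi> i x) = x"
  shows "card (commuting_radical_pairs (rep_End K Q V)) = card (commuting_radical_pairs (rep_End K Q W))"
proof -
  \<comment> \<open>Conjugation by the isomorphism; \<open>?k\<close> is its inverse.\<close>
  let ?h = "\<lambda>f. rep_compose Q W \<phi> (rep_compose Q W f \<psi>)"
  let ?k = "\<lambda>f. rep_compose Q V \<psi> (rep_compose Q V f \<phi>)"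
  interpret V: ring "rep_End K Q V" by (rule ring_rep_End) fact+
  interpret W: ring "rep_End K Q W" by (rule ring_rep_End) fact+
  have cV: "carrier (rep_End K Q V) = rep_hom K Q V V" and cW: "carrier (rep_End K Q W) = rep_hom K Q W W"
    by (simp_all add: rep_End_def)
  have h: "?h f \<in> rep_hom K Q W W" if "f \<in> rep_hom K Q V V" for f
    by (rule rep_hom_compose[OF W Q rep_hom_compose[OF W Q \<psi> that] \<phi>])
  have k: "?k f \<in> rep_hom K Q V V" if "f \<in> rep_hom K Q W W" for f
    by (rule rep_hom_compose[OF V Q rep_hom_compose[OF V Q \<phi> that] \<psi>])
  note app = rep_compose_apply rep_End_apply
  note clo = rep_hom_closed[OF \<phi>] rep_hom_closed[OF \<psi>]
  show ?thesis
  proof (rule card_commuting_radical_pairs_iso[of _ _ ?h])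
    show "?h \<in> ring_hom (rep_End K Q V) (rep_End K Q W)"
    proof (rule ring_hom_memI, unfold cV cW)
      fix f g assume f: "f \<in> rep_hom K Q V V" and g: "g \<in> rep_hom K Q V V"
      have fg: "f \<otimes>\<^bsub>rep_End K Q V\<^esub> g \<in> rep_hom K Q V V" "f \<oplus>\<^bsub>rep_End K Q V\<^esub> g \<in> rep_hom K Q V V"
        "?h f \<otimes>\<^bsub>rep_End K Q W\<^esub> ?h g \<in> rep_hom K Q W W" "?h f \<oplus>\<^bsub>rep_End K Q W\<^esub> ?h g \<in> rep_hom K Q W W"
        using V.m_closed[of f g] V.a_closed[of f g] W.m_closed[of "?h f" "?h g"]
          W.a_closed[of "?h f" "?h g"] f g h[OF f] h[OF g]
        unfolding cV cW by blast+
      show "?h (f \<otimes>\<^bsub>rep_End K Q V\<^esub> g) = ?h f \<otimes>\<^bsub>rep_End K Q W\<^esub> ?h g"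
        by (rule rep_hom_eqI[OF h[OF fg(1)] fg(3)])
          (simp add: app clo rep_hom_closed[OF f] rep_hom_closed[OF g] \<psi>\<phi>)
      show "?h (f \<oplus>\<^bsub>rep_End K Q V\<^esub> g) = ?h f \<oplus>\<^bsub>rep_End K Q W\<^esub> ?h g"
        by (rule rep_hom_eqI[OF h[OF fg(2)] fg(4)])
          (simp add: app clo rep_hom_closed[OF f] rep_hom_closed[OF g] rep_hom_add[OF \<phi>])
    next
      have one: "\<one>\<^bsub>rep_End K Q V\<^esub> \<in> rep_hom K Q V V" "\<one>\<^bsub>rep_End K Q W\<^esub> \<in> rep_hom K Q W W"
        using V.one_closed W.one_closed unfolding cV cW .
      show "?h \<one>\<^bsub>rep_End K Q V\<^esub> = \<one>\<^bsub>rep_End K Q W\<^esub>"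
        by (rule rep_hom_eqI[OF h[OF one(1)] one(2)]) (simp add: app clo \<phi>\<psi>)
    qed (rule h)
    show "bij_betw ?h (carrier (rep_End K Q V)) (carrier (rep_End K Q W))"
      unfolding cV cW
    proof (rule bij_betwI[of _ _ _ ?k])
      show "?k (?h f) = f" if f: "f \<in> rep_hom K Q V V" for f
        by (rule rep_hom_eqI[OF k[OF h[OF f]] f]) (simp add: app clo rep_hom_closed[OF f] \<psi>\<phi>)
      show "?h (?k f) = f" if f: "f \<in> rep_hom K Q W W" for f
        by (rule rep_hom_eqI[OF h[OF k[OF f]] f]) (simp add: app clo rep_hom_closed[OF f] \<phi>\<psi>)
    qed (auto intro: h k)
  qed (rule V.ring_axioms W.ring_axioms)+
qed

section \<open>Splitting an endomorphism ring along the components\<close>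

text \<open>The components partition the vertices, and each arrow has both ends in one of them.
  Hence every compatibility condition on an endomorphism involves one component only, and families
  of endomorphisms glue.\<close>

lemma ring_product_rep_End_components:
  assumes V: "is_quiver_rep K Q V" and Q: "fin_digraph Q"
  shows "ring_product (rep_End K Q V) (connected_components Q) (\<lambda>H. rep_End K H V)
    (\<lambda>H f. restrict f (verts H))"
proof (intro ring_product.intro ring_product_axioms.intro)
  interpret Q: fin_digraph Q by fact
  show "ring (rep_End K Q V)"
    by (rule ring_rep_End[OF V Q.wf_digraph_axioms])
  show "finite (connected_components Q)"
    by (rule Q.finite_connected_components)
  show "ring (rep_End K H V)" if "H \<in> connected_components Q" for H
    using ring_rep_End[OF is_quiver_rep_subgraph[OF V]] in_connected_components[OF that] by blast
  have res: "restrict f (verts H) \<in> rep_hom K H V V"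
    if H: "H \<in> connected_components Q" and f: "f \<in> rep_hom K Q V V" for H f
  proof (rule rep_homI)
    note c = in_connected_components[OF H]
    interpret H: wf_digraph H by (rule c(7))
    show "restrict f (verts H) i \<in> linear_maps K (rep_space V i) (rep_space V i)" if "i \<in> verts H" for i
      using that c(3) rep_homD(1)[OF f] by auto
    show "restrict f (verts H) (head H a) (rep_map V a x) = rep_map V a (restrict f (verts H) (tail H a) x)"
      if "a \<in> arcs H" "x \<in> carrier (rep_space V (tail H a))" for a x
      using that c(4-6) rep_homD(3)[OF f, of a x] H.wellformed[of a] by auto
  qed simp
  show "(\<lambda>f. restrict f (verts H)) \<in> ring_hom (rep_End K Q V) (rep_End K H V)"
    if H: "H \<in> connected_components Q" for H
    using in_connected_components(3)[OF H] res[OF H]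
    by (intro ring_hom_memI) (auto simp: rep_End_def fun_eq_iff restrict_def)
  show "bij_betw (\<lambda>f. \<lambda>H\<in>connected_components Q. restrict f (verts H)) (carrier (rep_End K Q V))
    (\<Pi>\<^sub>E H\<in>connected_components Q. carrier (rep_End K H V))"
    unfolding bij_betw_def
  proof (intro conjI equalityI subsetI)
    show "inj_on (\<lambda>f. \<lambda>H\<in>connected_components Q. restrict f (verts H)) (carrier (rep_End K Q V))"
    proof (rule inj_onI)
      fix f g assume "f \<in> carrier (rep_End K Q V)" "g \<in> carrier (rep_End K Q V)"
        and eq: "(\<lambda>H\<in>connected_components Q. restrict f (verts H)) =
          (\<lambda>H\<in>connected_components Q. restrict g (verts H))"
      then have fg: "f \<in> rep_hom K Q V V" "g \<in> rep_hom K Q V V" by (auto simp: rep_End_def)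
      show "f = g"
      proof (rule rep_hom_eqI[OF fg])
        fix i x assume "i \<in> verts Q"
        then obtain H where H: "H \<in> connected_components Q" "i \<in> verts H"
          by (rule Q.connected_components_cover)
        show "f i x = g i x"
          using fun_cong[OF fun_cong[OF eq, of H], of i] H by simp
      qed
    qed
    show "F \<in> (\<Pi>\<^sub>E H\<in>connected_components Q. carrier (rep_End K H V))"
      if "F \<in> (\<lambda>f. \<lambda>H\<in>connected_components Q. restrict f (verts H)) ` carrier (rep_End K Q V)" for F
      using that res by (auto simp: rep_End_def)
    fix F assume F: "F \<in> (\<Pi>\<^sub>E H\<in>connected_components Q. carrier (rep_End K H V))"
    then have FH: "F H \<in> rep_hom K H V V" if "H \<in> connected_components Q" for H
      using that by (auto simp: rep_End_def)
    define comp where "comp i = (SOME H. H \<in> connected_components Q \<and> i \<in> verts H)" for i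
    have comp_eq: "comp i = H" if "H \<in> connected_components Q" "i \<in> verts H" for i H
      unfolding comp_def
      by (rule some_equality) (use that connected_components_disjoint[OF _ that(1) _ that(2)] in blast)+
    have comp: "comp i \<in> connected_components Q" "i \<in> verts (comp i)" if i: "i \<in> verts Q" for i
    proof -
      obtain H where "H \<in> connected_components Q" "i \<in> verts H"
        by (rule Q.connected_components_cover[OF i])
      then show "comp i \<in> connected_components Q" "i \<in> verts (comp i)"
        using comp_eq by simp_all
    qed
    define f where "f = (\<lambda>i\<in>verts Q. F (comp i) i)"
    have "f \<in> rep_hom K Q V V"
    proof (rule rep_homI)
      show "f i \<in> linear_maps K (rep_space V i) (rep_space V i)" if "i \<in> verts Q" for i
        using rep_homD(1)[OF FH] comp[OF that] that by (simp add: f_def)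
      show "f (head Q a) (rep_map V a x) = rep_map V a (f (tail Q a) x)"
        if a: "a \<in> arcs Q" "x \<in> carrier (rep_space V (tail Q a))" for a x
      proof -
        note t = comp[OF Q.tail_in_verts[OF a(1)]]
        note c = in_connected_components[OF t(1)]
        have aH: "a \<in> arcs (comp (tail Q a))"
          using connected_components_arc[OF t(1) a(1)] t(2) by simp
        \<comment> \<open>At both ends of the arrow the glued \<open>f\<close> is taken from the
          same member of the family \<open>F\<close>, whose own compatibility then applies.\<close>
        then have "comp (head Q a) = comp (tail Q a)"
          using comp_eq[OF t(1)] wf_digraph.head_in_verts[OF c(7) aH] c(6) by simp
        then show ?thesis
          using rep_homD(3)[OF FH[OF t(1)] aH] a Q.wellformed[OF a(1)] c(5,6) by (simp add: f_def)
      qed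
    qed (simp add: f_def)
    moreover have "(\<lambda>H\<in>connected_components Q. restrict f (verts H)) H = F H" for H
    proof (cases "H \<in> connected_components Q")
      case True
      have "restrict f (verts H) i = F H i" for i
        using rep_homD(2)[OF FH[OF True], of i] in_connected_components(3)[OF True]
        by (cases "i \<in> verts H") (auto simp: f_def comp_eq[OF True])
      then show ?thesis using True by auto
    next
      case False
      then show ?thesis using PiE_arb[OF F] by simp
    qed
    ultimately show "F \<in> (\<lambda>f. \<lambda>H\<in>connected_components Q. restrict f (verts H)) ` carrier (rep_End K Q V)"
      by (intro image_eqI[of _ _ f]) (auto simp: rep_End_def fun_eq_iff)
  qed
qed


section \<open>Restricting a projective representation to a component\<close>

lemma commuting_count_eq_card:
  "commuting_count K Q d = card (commuting_radical_pairs (rep_End K Q (proj_sum K Q d)))"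
  by (simp only: commuting_count_def commuting_radical_pairs_def Let_def)

lemma proj_sum_space:
  "rep_space (proj_sum K Q d) j =
    module_sum (SIGMA i:verts Q. {..<d i}) (\<lambda>s. free_module K (paths Q (fst s) j))"
  by (simp add: proj_sum_def rep_sum_def proj_rep_def case_prod_unfold)

lemma proj_sum_map:
  "x \<in> carrier (rep_space (proj_sum K Q d) (tail Q a)) \<Longrightarrow>
    rep_map (proj_sum K Q d) a x =
      (\<lambda>s\<in>(SIGMA i:verts Q. {..<d i}). rep_map (proj_rep K Q (fst s)) a (x s))"
  by (simp add: proj_sum_def rep_sum_def case_prod_unfold)

text \<open>No path leads from a vertex outside a component into it, so the projective at such a
  vertex has zero spaces there. In the extensional encoding their only element is
  \<open>\<lambda>_. undefined\<close>.\<close>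

lemma free_module_empty:
  "carrier (free_module K {}) = {\<lambda>_. undefined}" "add (free_module K {}) x y = (\<lambda>_. undefined)"
  "smult (free_module K {}) c x = (\<lambda>_. undefined)"
  by (auto simp: free_module_def)

text \<open>For \<open>i\<close> outside \<open>H\<close> the arrow acts between two zero spaces;
  the second branch is the only map between them, in extensional form.\<close>

lemma proj_rep_map_component:
  assumes "H \<in> connected_components Q" and "a \<in> arcs H"
  shows "rep_map (proj_rep K Q i) a = 
    (if i \<in> verts H then rep_map (proj_rep K H i) a else (\<lambda>x\<in>{\<lambda>_. undefined}. \<lambda>_. undefined))"
proof -
  note c = in_connected_components[OF assms(1)]
  have "tail H a \<in> verts H" "head H a \<in> verts H"
    using wf_digraph.wellformed[OF c(7) assms(2)] by auto
  then show ?thesis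
    using c(5,6) by (auto simp: proj_rep_def paths_connected_component[OF assms(1)] free_module_empty
        restrict_def)
qed

text \<open>Seen over \<open>H\<close>, the sum of projectives of \<open>Q\<close> differs from that
  of \<open>H\<close> only by coordinates with values in zero spaces. Dropping these coordinates is
  an isomorphism, and it preserves the count.\<close>

lemma card_commuting_radical_pairs_component:
  assumes K: "field K" and H: "H \<in> connected_components Q"
  shows "card (commuting_radical_pairs (rep_End K H (proj_sum K Q d))) =
    commuting_count K H (restrict d (verts H))"
proof -
  note c = in_connected_components[OF H]
  interpret H: wf_digraph H by (rule c(7))
  define V W where "V = proj_sum K Q d" and "W = proj_sum K H (restrict d (verts H))"
  define S T where "S = (SIGMA i:verts Q. {..<d i})" and "T = (SIGMA i:verts H. {..<restrict d (verts H) i})"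
  have T: "s \<in> T \<longleftrightarrow> s \<in> S \<and> fst s \<in> verts H" for s
    using c(3) by (auto simp: S_def T_def)
  \<comment> \<open>Two kinds of \<open>undefined\<close> meet here: a coordinate in
    \<open>S\<close> outside \<open>H\<close> is the zero vector
    \<open>\<lambda>_. undefined\<close>, while an index outside \<open>S\<close> yields
    \<open>undefined\<close> itself.\<close>
  let ?ext = "\<lambda>x. \<lambda>s\<in>S. if fst s \<in> verts H then x s else (\<lambda>_. undefined)"
  let ?\<phi> = "\<lambda>j\<in>verts H. \<lambda>x\<in>carrier (rep_space V j). restrict x T"
  let ?\<psi> = "\<lambda>j\<in>verts H. \<lambda>x\<in>carrier (rep_space W j). ?ext x"
  have V: "is_quiver_rep K H V"
    unfolding V_def by (rule is_quiver_rep_subgraph[OF is_quiver_rep_proj_sum[OF K c(8)] c(1)])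
  have W: "is_quiver_rep K H W"
    unfolding W_def by (rule is_quiver_rep_proj_sum[OF K c(7)])
  note VD = is_quiver_repD[OF V] and WD = is_quiver_repD[OF W]
  have Vj: "rep_space V j = module_sum S
      (\<lambda>s. if fst s \<in> verts H then free_module K (paths H (fst s) j) else free_module K {})"
    if "j \<in> verts H" for j
    unfolding V_def proj_sum_space S_def
    by (intro arg_cong[of _ _ "module_sum _"] ext) (simp add: paths_connected_component[OF H that])
  have Wj: "rep_space W j = module_sum T (\<lambda>s. free_module K (paths H (fst s) j))" for j
    by (simp only: W_def proj_sum_space T_def)
  have V_closed: "restrict x T \<in> carrier (rep_space W j)"
    if "j \<in> verts H" "x \<in> carrier (rep_space V j)" for j x
    using that unfolding Vj[OF that(1)] Wj
    by (auto simp: module_sum_def PiE_iff T split: if_splits)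
  have W_closed: "?ext x \<in> carrier (rep_space V j)"
    if "j \<in> verts H" "x \<in> carrier (rep_space W j)" for j x
    using that unfolding Vj[OF that(1)] Wj
    by (auto simp: module_sum_def PiE_iff T free_module_empty)
  have V_off: "x s = (\<lambda>_. undefined)"
    if "j \<in> verts H" "x \<in> carrier (rep_space V j)" "s \<in> S" "fst s \<notin> verts H" for j x s
    using that(2-4) unfolding Vj[OF that(1)]
    by (auto simp: module_sum_def PiE_iff free_module_empty dest!: bspec[of _ _ s])
  have V_ext: "x s = undefined" if "j \<in> verts H" "x \<in> carrier (rep_space V j)" "s \<notin> S" for j x s
    using that(2,3) unfolding Vj[OF that(1)]
    by (intro PiE_arb[of x S]) (simp_all add: module_sum_def)
  have W_ext: "x s = undefined" if "x \<in> carrier (rep_space W j)" "s \<notin> T" for j x s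
    using that unfolding Wj by (intro PiE_arb[of x T]) (simp_all add: module_sum_def)
  have V_map: "rep_map V a x = (\<lambda>s\<in>S. if fst s \<in> verts H then rep_map (proj_rep K H (fst s)) a (x s) else (\<lambda>_. undefined))"
    if "a \<in> arcs H" "x \<in> carrier (rep_space V (tail H a))" for a x
  proof -
    have x: "x \<in> carrier (rep_space (proj_sum K Q d) (tail Q a))"
      using that(2) c(5) by (simp add: V_def)
    show ?thesis
      unfolding V_def proj_sum_map[OF x] S_def[symmetric]
      using V_off[OF H.tail_in_verts[OF that(1)] that(2)]
      by (intro restrict_ext) (simp add: proj_rep_map_component[OF H that(1)])
  qed
  have W_map: "rep_map W a x = (\<lambda>s\<in>T. rep_map (proj_rep K H (fst s)) a (x s))"
    if "x \<in> carrier (rep_space W (tail H a))" for a x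
    using that unfolding W_def T_def by (rule proj_sum_map)
  have "?\<phi> \<in> rep_hom K H V W"
  proof (rule rep_homI)
    show "?\<phi> j \<in> linear_maps K (rep_space V j) (rep_space W j)" if j: "j \<in> verts H" for j
    proof (rule linear_mapsI)
      interpret Vj: module K "rep_space V j" by (rule VD(1)[OF j])
      show "?\<phi> j (x \<oplus>\<^bsub>rep_space V j\<^esub> y) = ?\<phi> j x \<oplus>\<^bsub>rep_space W j\<^esub> ?\<phi> j y"
        if "x \<in> carrier (rep_space V j)" "y \<in> carrier (rep_space V j)" for x y
        using that j by simp (simp add: Vj[OF j] Wj module_sum_def fun_eq_iff T del: split_paired_All)
      show "?\<phi> j (k \<odot>\<^bsub>rep_space V j\<^esub> x) = k \<odot>\<^bsub>rep_space W j\<^esub> ?\<phi> j x"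
        if "k \<in> carrier K" "x \<in> carrier (rep_space V j)" for k x
        using that j by simp (simp add: Vj[OF j] Wj module_sum_def fun_eq_iff T del: split_paired_All)
    qed (use j V_closed in auto)
    show "?\<phi> (head H a) (rep_map V a x) = rep_map W a (?\<phi> (tail H a) x)"
      if a: "a \<in> arcs H" and x: "x \<in> carrier (rep_space V (tail H a))" for a x
      using H.wellformed[OF a] x VD(3)[OF a x] W_map[OF V_closed[OF _ x]]
      by (simp add: V_map[OF a x] fun_eq_iff T del: split_paired_All)
  qed simp
  moreover have "?\<psi> \<in> rep_hom K H W V"
  proof (rule rep_homI)
    show "?\<psi> j \<in> linear_maps K (rep_space W j) (rep_space V j)" if j: "j \<in> verts H" for j
    proof (rule linear_mapsI)
      interpret Wj: module K "rep_space W j" by (rule WD(1)[OF j])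
      show "?\<psi> j (x \<oplus>\<^bsub>rep_space W j\<^esub> y) = ?\<psi> j x \<oplus>\<^bsub>rep_space V j\<^esub> ?\<psi> j y"
        if "x \<in> carrier (rep_space W j)" "y \<in> carrier (rep_space W j)" for x y
        using that j by simp (simp add: Vj[OF j] Wj module_sum_def fun_eq_iff T free_module_empty
            del: split_paired_All)
      show "?\<psi> j (k \<odot>\<^bsub>rep_space W j\<^esub> x) = k \<odot>\<^bsub>rep_space V j\<^esub> ?\<psi> j x"
        if "k \<in> carrier K" "x \<in> carrier (rep_space W j)" for k x
        using that j by simp (simp add: Vj[OF j] Wj module_sum_def fun_eq_iff T free_module_empty
            del: split_paired_All)
    qed (use j W_closed in auto)
    show "?\<psi> (head H a) (rep_map W a x) = rep_map V a (?\<psi> (tail H a) x)"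
      if a: "a \<in> arcs H" and x: "x \<in> carrier (rep_space W (tail H a))" for a x
      using H.wellformed[OF a] x WD(3)[OF a x] V_map[OF a W_closed[OF _ x]]
      by (simp add: W_map[OF x] fun_eq_iff T del: split_paired_All)
  qed simp
  moreover have "?\<psi> j (?\<phi> j x) = x" if "j \<in> verts H" "x \<in> carrier (rep_space V j)" for j x
    using that V_closed[OF that] V_off[OF that] V_ext[OF that] by (auto simp: fun_eq_iff T simp del: split_paired_All)
  moreover have "?\<phi> j (?\<psi> j x) = x" if "j \<in> verts H" "x \<in> carrier (rep_space W j)" for j x
    using that W_closed[OF that] W_ext[OF that(2)] by (auto simp: fun_eq_iff T simp del: split_paired_All)
  ultimately have "card (commuting_radical_pairs (rep_End K H V)) = card (commuting_radical_pairs (rep_End K H W))"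
    by (rule card_commuting_radical_pairs_rep_End_iso[OF V W c(7)])
  then show ?thesis
    by (simp add: commuting_count_eq_card V_def W_def)
qed

theorem theorem3p12:
  fixes K :: "('k, 'r) ring_scheme"
    and Q :: "('v, 'e) pre_digraph"
    and d :: "'v \<Rightarrow> nat"
    and n :: nat
    and C :: "nat \<Rightarrow> ('v, 'e) pre_digraph"
  assumes "field K" and "finite (carrier K)"
    and "fin_digraph Q"
    and "\<nexists>p. pre_digraph.cycle Q p"
    and "bij_betw C {1..n} (connected_components Q)"
  shows "commuting_count K Q d = (\<Prod>k = 1..n. commuting_count K (C k) (restrict d (verts (C k))))"
proof -
  interpret Q: fin_digraph Q by fact
  let ?V = "proj_sum K Q d"
  interpret ring_product "rep_End K Q ?V" "connected_components Q" "\<lambda>H. rep_End K H ?V"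
    "\<lambda>H f. restrict f (verts H)"
    by (rule ring_product_rep_End_components[OF is_quiver_rep_proj_sum[OF assms(1) Q.wf_digraph_axioms] assms(3)])
  have "commuting_count K Q d = card (commuting_radical_pairs (rep_End K Q ?V))"
    by (simp add: commuting_count_eq_card)
  \<comment> \<open>The product formula gives the counts for the restrictions of \<open>?V\<close>;
    each is then replaced by the count for the projectives of the component itself.\<close>
  also have "\<dots> = (\<Prod>H\<in>connected_components Q. commuting_count K H (restrict d (verts H)))"
    using card_commuting_radical_pairs
    by (simp add: card_commuting_radical_pairs_component[OF assms(1)])
  also have "\<dots> = (\<Prod>k = 1..n. commuting_count K (C k) (restrict d (verts (C k))))"
    by (rule prod.reindex_bij_betw[OF assms(5), symmetric])
  finally show ?thesis .
qed

end
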